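(* Let $d\ge1$, let $N$ and $\nu$ be positive integers, and let $f$ and $g$ be measurable real-valued functions on a measurable set $R\subset\mathbb{R}^{d}$ which contains $\mathbf{0}$ as an interior point. Suppose that $f$ attains its unique minimum value of $0$ at $\mathbf{0}$ and is otherwise bounded away from zero (for every $\delta>0$, $\inf\{f(\mathbf{x}):\mathbf{x}\in R,\ |\mathbf{x}|\ge\delta\}>0$), and that there exists $k_{0}>0$ such that $\int_{R}e^{-k_{0}f}g\,d^{d}\mathbf{x}$ converges. Suppose that $f$ and $g$ are smooth enough to be given near $\mathbf{0}$ as Taylor series with remainder $$f(\mathbf{x})=\sum_{\nu\le|\alpha|\le N+\nu}\frac{1}{\alpha!}D^{\alpha}f(\mathbf{0})\mathbf{x}^{\alpha}+O(|\mathbf{x}|^{N+\nu+1}),\qquad g(\mathbf{x})=\sum_{0\le|\beta|\le N}\frac{1}{\beta!}D^{\beta}g(\mathbf{0})\mathbf{x}^{\beta}+O(|\mathbf{x}|^{N+1}),\qquad \mathbf{x}\to\mathbf{0},$$ where $f_{0}(\Omega):=\sum_{|\alpha|=\nu}\frac{D^{\alpha}f(\mathbf{0})}{\alpha!}\Omega^{\alpha}$, $\Omega\in S^{d-1}$, is a positive constant $f_{0}$. Then there exists an asymptotic expansion $$\int_{R}e^{-kf}g\,d^{d}\mathbf{x}=k^{-d/\nu}\sum_{j=0}^{N}\zeta_{j}k^{-j/\nu}+O\left(k^{-(N+d+1)/\nu}\right),\qquad k\to\infty,$$ where the coefficients are given by $$\zeta_{j}=\frac{1}{\nu}\Gamma\left(\frac{d+j}{\nu}\right)f_{0}^{-(j+d)/\nu}\sum_{m=0}^{j}\sum_{r=1}^{m}\binom{-\frac{d+j}{\nu}}{r}f_{0}^{-r}\sum_{|\beta|=j-m}\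 \sum_{\substack{n_{1}+\cdots+n_{r}=m\\ n_{i}\geq1,\ i=1,\dots,r}}\ \sum_{|\alpha_{1}|=n_{1}+\nu}\cdots\sum_{|\alpha_{r}|=n_{r}+\nu}w_{\beta+\alpha_{1}+\cdots+\alpha_{r}}\frac{D^{\beta}g(\mathbf{0})D^{\alpha_{1}}f(\mathbf{0})\cdots D^{\alpha_{r}}f(\mathbf{0})}{\beta!\,\alpha_{1}!\cdots\alpha_{r}!},$$ where for a multi-index $\alpha=(\alpha^{1},\dots,\alpha^{d})$, $$w_{\alpha}:=(2\pi)^{d/2}\,c_{d}\,\frac{(\alpha-\mathbf{1})!!}{(|\alpha|+d-2)!!}\operatorname{even}(\alpha),\qquad c_{d}=\begin{cases}1&\text{if } d \text{ is even}\\ \sqrt{2/\pi}&\text{if } d\text{ is odd.}\end{cases}$$ Here the (empty) sum over $r$ for $m=0$ is understood as a single term $r=0$ containing no $n_i$ and no $\alpha_i$, i.e. the $m=0$ contribution to the sum over $m$ is $\sum_{|\beta|=j}w_{\beta}\frac{D^{\beta}g(\mathbf{0})}{\beta!}$.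
   Context: $\beta,\alpha,\alpha_1,\dots,\alpha_r$ range over multi-indices in $\mathbb{Z}_{\ge0}^{d}$; $|\alpha|=\sum_p\alpha^{p}$, $\alpha!=\prod_p\alpha^{p}!$, $\mathbf{x}^{\alpha}=\prod_p(x^{p})^{\alpha^{p}}$, $D^{\alpha}$ is the mixed partial derivative of order $\alpha$, $\mathbf{1}=(1,\dots,1)$, and $\alpha!!=\prod_p\alpha^{p}!!$ componentwise, where $n!!=n(n-2)(n-4)\cdots$ (ending at $2$ for even $n$, at $3$ or equivalently $1$ for odd $n$), with $(-1)!!=0!!=1!!=1$. $\operatorname{even}(\alpha)=1$ if all components of $\alpha$ are even, and $0$ otherwise. $S^{d-1}=\{|\mathbf{x}|=1\}\subset\mathbb{R}^{d}$. $\binom{a}{r}=a(a-1)\cdots(a-r+1)/r!$ for real $a$. Integrals are Lebesgue integrals, and "converges" means the integrand is Lebesgue integrable. $h(k)=O(k^{p})$ as $k\to\infty$ means $|h(k)|\le Ck^{p}$ for some constant $C>0$ and all sufficiently large $k$. *)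

theory Defs
  imports "HOL-Analysis.Analysis" "HOL-Library.Landau_Symbols" "HOL-Library.Multiset"
begin

type_synonym 'd multi_index = "nat ^ 'd"

definition mi_size :: "('d::finite) multi_index \<Rightarrow> nat" where
  "mi_size \<alpha> = (\<Sum>p\<in>UNIV. \<alpha> $ p)"

definition mi_fact :: "('d::finite) multi_index \<Rightarrow> real" where
  "mi_fact \<alpha> = (\<Prod>p\<in>UNIV. fact (\<alpha> $ p))"

definition mi_power :: "real ^ 'd \<Rightarrow> ('d::finite) multi_index \<Rightarrow> real" where
  "mi_power x \<alpha> = (\<Prod>p\<in>UNIV. (x $ p) ^ (\<alpha> $ p))"

lemma finite_mi_size_le: "finite {\<alpha> :: ('d::finite) multi_index. mi_size \<alpha> \<le> n}"
proof -
  have "{\<alpha> :: ('d::finite) multi_index. mi_size \<alpha> \<le> n} \<subseteq> vec_lambda ` (UNIV \<rightarrow>\<^sub>E {..n})"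
  proof
    fix \<alpha> :: "'d multi_index"
    assume "\<alpha> \<in> {\<alpha>. mi_size \<alpha> \<le> n}"
    then have "\<alpha> $ p \<le> n" for p
      using member_le_sum[of p UNIV "($) \<alpha>"] by (auto simp: mi_size_def intro: le_trans)
    then have "vec_nth \<alpha> \<in> UNIV \<rightarrow>\<^sub>E {..n}" by auto
    then show "\<alpha> \<in> vec_lambda ` (UNIV \<rightarrow>\<^sub>E {..n})"
      by (metis image_eqI vec_nth_inverse)
  qed
  then show ?thesis
    by (rule finite_subset) (intro finite_imageI finite_PiE; simp)
qed

definition partial_deriv :: "'d \<Rightarrow> (real ^ 'd \<Rightarrow> real) \<Rightarrow> real ^ 'd \<Rightarrow> real" where
  "partial_deriv p f x = deriv (\<lambda>t. f (x + t *\<^sub>R axis p 1)) 0"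

(* The index type carries no order, so the partial derivatives are taken in an arbitrary order,
   fixed once for each multi-index; \<alpha> $ p of them are in the direction p. *)
definition mixed_deriv :: "('d::finite) multi_index \<Rightarrow> (real ^ 'd \<Rightarrow> real) \<Rightarrow> real ^ 'd \<Rightarrow> real" where
  "mixed_deriv \<alpha> f = foldr partial_deriv (SOME ps. \<forall>p. count_list ps p = \<alpha> $ p) f"

lemma ex_list_count_eq_mi: "\<exists>ps. \<forall>p. count_list ps p = (\<alpha> :: ('d::finite) multi_index) $ p"
proof -
  obtain ps where "mset ps = Abs_multiset (($) \<alpha>)"
    using ex_mset by blast
  then have "count_list ps p = \<alpha> $ p" for p
    by (metis count_Abs_multiset count_mset finite)
  then show ?thesis by blast
qed

(* On the integers, so that (-1)!! = 1 is a genuine value and not a case of truncated subtraction. *)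
function double_fact :: "int \<Rightarrow> nat" where
  "double_fact n = (if n \<le> 0 then 1 else nat n * double_fact (n - 2))"
  by auto
termination by (relation "Wellfounded.measure nat") auto
declare double_fact.simps [simp del]

definition sphere_const :: "nat \<Rightarrow> real" where
  "sphere_const d = (if even d then 1 else sqrt (2 / pi))"

definition sphere_weight :: "('d::finite) multi_index \<Rightarrow> real" where
  "sphere_weight \<alpha> =
     (2 * pi) powr (real CARD('d) / 2) * sphere_const CARD('d) *
     (real (\<Prod>p\<in>UNIV. double_fact (int (\<alpha> $ p) - 1)) /
      real (double_fact (int (mi_size \<alpha>) + int CARD('d) - 2))) *
     of_bool (\<forall>p. even (\<alpha> $ p))"

(* Compositions of m into r positive parts; for r = 0 this is {[]} if m = 0, and empty otherwise. *)
definition compositions :: "nat \<Rightarrow> nat \<Rightarrow> nat list set" where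
  "compositions r m = {ns. length ns = r \<and> (\<forall>n\<in>set ns. 1 \<le> n) \<and> sum_list ns = m}"

(* In the sum over r, the index set {0} for m = 0 gives the single term
   (\<Sum>|\<beta>|=j. w_\<beta> D^\<beta> g(0) / \<beta>!), the convention for the empty sum.
   The list \<alpha>s holds the multi-indices \<alpha>_1, ..., \<alpha>_r. *)
definition laplace_coeff ::
  "(real ^ 'd \<Rightarrow> real) \<Rightarrow> (real ^ 'd \<Rightarrow> real) \<Rightarrow> real \<Rightarrow> nat \<Rightarrow> nat \<Rightarrow> real" where
  "laplace_coeff f g f\<^sub>0 \<nu> j =
     1 / real \<nu> * Gamma ((real CARD('d) + real j) / real \<nu>) *
     f\<^sub>0 powr (- (real j + real CARD('d)) / real \<nu>) *
     (\<Sum>m=0..j. \<Sum>r\<in>(if m = 0 then {0} else {1..m}).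
        ((- (real CARD('d) + real j) / real \<nu>) gchoose r) * (1 / f\<^sub>0 ^ r) *
        (\<Sum>\<beta> | mi_size \<beta> = j - m. \<Sum>ns\<in>compositions r m.
         \<Sum>\<alpha>s | length \<alpha>s = r \<and> (\<forall>i<r. mi_size (\<alpha>s ! i) = ns ! i + \<nu>).
           sphere_weight (\<beta> + (\<Sum>i<r. \<alpha>s ! i)) *
           (mixed_deriv \<beta> g 0 * (\<Prod>i<r. mixed_deriv (\<alpha>s ! i) f 0)) /
           (mi_fact \<beta> * (\<Prod>i<r. mi_fact (\<alpha>s ! i)))))"

end

theory Submission imports Defs begin

text \<open>
  Since the lowest-order part of \<open>f\<close> is the constant \<open>c = f\<^sub>0\<close> on the sphere, near the origin
  \<open>f x = c * norm x ^ \<nu> + E x\<close> with \<open>E x = O(norm x ^ (\<nu> + 1))\<close>.  The factor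
  \<open>exp (- k * c * norm x ^ \<nu>)\<close> is kept, and \<open>exp (- k * E x)\<close> is expanded into its power series up
  to order \<open>N\<close>.  Under the kept factor the effective size of \<open>norm x\<close> is \<open>k powr (- 1 / \<nu>)\<close>, so
  \<open>k ^ r\<close> times a function homogeneous of degree \<open>p\<close> integrates to order
  \<open>k powr (r - (d + p) / \<nu>)\<close>.  The product \<open>E ^ r * g\<close> is a sum of homogeneous polynomials of the
  degrees \<open>r * \<nu> + j\<close> for \<open>j \<le> N\<close>, up to \<open>O(norm x ^ (r * \<nu> + N + 1))\<close>
  (lemma \<open>graded_expansion_prod_part\<close>).  The part with indices \<open>r\<close> and \<open>j\<close> therefore contributes
  exactly a multiple of \<open>k powr (- (d + j) / \<nu>)\<close>, and whatever is dropped, the remainder of the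
  exponential series with its \<open>(k * E x) ^ (N + 1)\<close> included, is bounded by
  terms \<open>k ^ r * norm x ^ (r * \<nu> + N + 1)\<close> times an exponential, hence has an integral of order
  \<open>k powr (- (d + N + 1) / \<nu>)\<close>.

  The parts that are kept are integrated over the whole space.  Far from the origin they are
  bounded by the same terms, because \<open>norm x \<ge> \<delta>\<close> allows missing powers of \<open>norm x\<close> to be
  supplied at the price of powers of \<open>\<delta>\<close>; the original integrand is exponentially small there
  because \<open>f\<close> is bounded away from zero.  All of this is one pointwise inequality,
  \<open>laplace_pointwise_bound\<close>.

  The integral of \<open>exp (- c * norm x ^ \<nu>)\<close> times a monomial is found without polar coordinates.
  Writing \<open>exp (- a)\<close> as the integral of \<open>exp (- t)\<close> over \<open>t \<ge> a\<close> and exchanging the order of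
  integration leaves integrals of the monomial over balls.  These scale by a power of the radius, so
  the result is a value of the Gamma function times the integral over the unit ball.  The latter is
  independent of \<open>\<nu>\<close> and can be read off from \<open>\<nu> = 2\<close>, where the exponential is a product
  over the coordinates.  In the final formula the sign and factorial of the exponential series
  and the quotient of \<open>Gamma ((d + j) / \<nu> + r)\<close> by \<open>Gamma ((d + j) / \<nu>)\<close> make up the generalised
  binomial coefficient.
\<close>

section \<open>Integrals of homogeneous functions against a radial exponential\<close>

lemma nn_integral_homogeneous_cball:
  fixes q :: "'a::euclidean_space \<Rightarrow> real"
  assumes [measurable]: "q \<in> borel_measurable borel"
    and hom: "\<And>s x. 0 < s \<Longrightarrow> q (s *\<^sub>R x) = s ^ p * q x"
    and "0 < s"
  shows "(\<integral>\<^sup>+x. ennreal (q x) * indicator (cball 0 s) x \<partial>lborel) =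
         ennreal (s ^ (DIM('a) + p)) * (\<integral>\<^sup>+x. ennreal (q x) * indicator (cball 0 1) x \<partial>lborel)"
proof -
  note [measurable] = borel_closed[OF closed_cball]
  have [measurable]: "(\<lambda>x. ennreal (q x) * indicator (cball 0 s) x) \<in> borel_measurable borel"
    by measurable
  have "(\<integral>\<^sup>+x. ennreal (q x) * indicator (cball 0 s) x \<partial>(lborel :: 'a measure)) =
        (\<integral>\<^sup>+x. ennreal (q x) * indicator (cball 0 s) x
           \<partial>density (distr lborel borel (\<lambda>x::'a. 0 + s *\<^sub>R x)) (\<lambda>_. \<bar>s\<bar> ^ DIM('a)))"
    using \<open>0 < s\<close> by (subst lborel_affine[of s 0]) auto
  also have "\<dots> = (\<integral>\<^sup>+x. ennreal (s ^ DIM('a)) * (ennreal (q (s *\<^sub>R x)) * indicator (cball 0 s) (s *\<^sub>R x)) \<partial>lborel)"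
    using \<open>0 < s\<close> by (subst nn_integral_density) (simp_all add: nn_integral_distr)
  also have "\<dots> = (\<integral>\<^sup>+x. ennreal (s ^ (DIM('a) + p)) * (ennreal (q x) * indicator (cball 0 1) x) \<partial>lborel)"
  proof (intro nn_integral_cong)
    fix x :: 'a
    have "ennreal (q (s *\<^sub>R x)) = ennreal (s ^ p) * ennreal (q x)"
      using \<open>0 < s\<close> by (simp add: hom ennreal_mult')
    moreover have "ennreal (s ^ (DIM('a) + p)) = ennreal (s ^ DIM('a)) * ennreal (s ^ p)"
      using \<open>0 < s\<close> by (simp add: power_add ennreal_mult')
    ultimately show "ennreal (s ^ DIM('a)) * (ennreal (q (s *\<^sub>R x)) * indicator (cball 0 s) (s *\<^sub>R x)) =
        ennreal (s ^ (DIM('a) + p)) * (ennreal (q x) * indicator (cball 0 1) x)"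
      using \<open>0 < s\<close> by (auto simp: mult_ac split: split_indicator)
  qed
  finally show ?thesis by (simp add: nn_integral_cmult)
qed

lemma nn_integral_exp_tail:
  fixes a :: real
  shows "(\<integral>\<^sup>+t. ennreal (exp (- t)) * indicator {a..} t \<partial>lborel) = ennreal (exp (- a))"
proof -
  have "(\<integral>\<^sup>+t. ennreal (exp (- t)) * indicator {a..} t \<partial>lborel) = ennreal (0 - (- exp (- a)))"
  proof (rule nn_integral_FTC_atLeast)
    show "((\<lambda>t::real. - exp (- t)) \<longlongrightarrow> 0) at_top"
      using tendsto_minus[OF filterlim_compose[OF exp_at_bot filterlim_uminus_at_bot_at_top]] by simp
  qed (auto intro!: derivative_eq_intros)
  then show ?thesis by simp
qed

text \<open>
  The layer-cake argument: \<open>exp (- c * norm x ^ \<nu>)\<close> is the integral of \<open>exp (- t)\<close> over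
  \<open>t \<ge> c * norm x ^ \<nu>\<close>.  For fixed \<open>t\<close> this restricts \<open>x\<close> to the ball of radius
  \<open>(t / c) powr (1 / \<nu>)\<close>, over which \<open>q\<close> integrates to a power of \<open>t\<close> by scaling; the remaining
  integral in \<open>t\<close> is Euler's integral for Gamma.  The integral over the unit ball is left
  unevaluated and does not depend on \<open>\<nu>\<close> or \<open>c\<close>.
\<close>
lemma nn_integral_exp_norm_homogeneous:
  fixes q :: "'a::euclidean_space \<Rightarrow> real"
  assumes q [measurable]: "q \<in> borel_measurable borel" and nonneg: "\<And>x. 0 \<le> q x"
    and hom: "\<And>s x. 0 < s \<Longrightarrow> q (s *\<^sub>R x) = s ^ p * q x"
    and "0 < c" and "1 \<le> \<nu>"
  shows "(\<integral>\<^sup>+x. ennreal (exp (- c * norm x ^ \<nu>) * q x) \<partial>lborel) =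
         ennreal (Gamma (real (DIM('a) + p) / \<nu> + 1) * c powr (- real (DIM('a) + p) / \<nu>)) *
         (\<integral>\<^sup>+x. ennreal (q x) * indicator (cball 0 1) x \<partial>lborel)"
proof -
  note [measurable] = borel_closed[OF closed_cball]
  let ?n = "DIM('a) + p" and ?H = "\<integral>\<^sup>+x. ennreal (q x) * indicator (cball 0 1) x \<partial>lborel"
  let ?I = "\<lambda>x t. indicator {(x, t). c * norm x ^ \<nu> \<le> t} (x, t) :: ennreal"
  have n: "0 < ?n" by simp
  have meas [measurable]: "{(x :: 'a, t). c * norm x ^ \<nu> \<le> t} \<in> sets (borel \<Otimes>\<^sub>M borel)"
    unfolding borel_prod case_prod_unfold
    by (intro borel_closed closed_Collect_le continuous_intros)
  \<comment> \<open>At \<open>t = 0\<close> the ball degenerates to a point; this null set is left out of the claim.\<close>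
  have inner: "(\<integral>\<^sup>+x. ennreal (q x) * ennreal (exp (- t)) * ?I x t \<partial>lborel) =
      ennreal (indicator {0..} t * t powr (real ?n / \<nu> + 1 - 1) / exp t) *
      (ennreal (c powr (- real ?n / \<nu>)) * ?H)" if "t \<noteq> 0" for t
  proof (cases "0 < t")
    case True
    define s where "s = (t / c) powr (1 / \<nu>)"
    have s: "0 < s" "s ^ \<nu> = t / c" "s ^ ?n = (t / c) powr (?n / \<nu>)"
      using True assms(4,5) by (auto simp: s_def simp flip: powr_realpow' powr_powr powr_realpow)
        (auto simp: powr_powr simp flip: powr_realpow)
    have iff: "c * norm x ^ \<nu> \<le> t \<longleftrightarrow> norm x \<le> s" for x :: 'a
    proof -
      have "c * norm x ^ \<nu> \<le> t \<longleftrightarrow> norm x ^ \<nu> \<le> s ^ \<nu>"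
        using assms(4) by (simp add: s field_simps)
      also have "\<dots> \<longleftrightarrow> norm x \<le> s" using s assms(5) by (intro power_mono_iff) auto
      finally show ?thesis .
    qed
    have "(\<integral>\<^sup>+x. ennreal (q x) * ennreal (exp (- t)) * ?I x t \<partial>lborel) =
          (\<integral>\<^sup>+x. ennreal (exp (- t)) * (ennreal (q x) * indicator (cball 0 s) x) \<partial>lborel)"
      by (intro nn_integral_cong) (auto simp: iff mult_ac split: split_indicator)
    also have "\<dots> = ennreal (exp (- t)) * (ennreal (s ^ ?n) * ?H)"
      by (simp add: nn_integral_cmult nn_integral_homogeneous_cball[OF q hom s(1)])
    also have "\<dots> = ennreal (exp (- t) * s ^ ?n) * ?H"
      using s(1) by (simp add: ennreal_mult' mult_ac)
    also have "exp (- t) * s ^ ?n =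
        (indicator {0..} t * t powr (real ?n / \<nu> + 1 - 1) / exp t) * c powr (- real ?n / \<nu>)"
    proof -
      have "(t / c) powr a = t powr a * c powr (- a)" for a
        using True \<open>0 < c\<close> by (simp add: powr_divide powr_minus_divide)
      then show ?thesis unfolding s(3) minus_divide_left[symmetric]
        using True by (simp add: exp_minus divide_inverse mult_ac)
    qed
    finally show ?thesis by (subst (asm) ennreal_mult') (auto simp: mult_ac)
  next
    case False
    have "\<not> c * norm x ^ \<nu> \<le> t" for x :: 'a
    proof -
      have "0 \<le> c * norm x ^ \<nu>" using \<open>0 < c\<close> by simp
      then show ?thesis using False that by linarith
    qed
    then show ?thesis using False that by simp
  qed
  have "(\<integral>\<^sup>+x. ennreal (exp (- c * norm x ^ \<nu>) * q x) \<partial>lborel) =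
        (\<integral>\<^sup>+x. \<integral>\<^sup>+t. ennreal (q x) * ennreal (exp (- t)) * ?I x t \<partial>lborel \<partial>lborel)"
  proof (intro nn_integral_cong)
    fix x :: 'a
    have "(\<integral>\<^sup>+t. ennreal (q x) * ennreal (exp (- t)) * ?I x t \<partial>lborel) =
          (\<integral>\<^sup>+t. ennreal (q x) * (ennreal (exp (- t)) * indicator {c * norm x ^ \<nu>..} t) \<partial>lborel)"
      by (intro nn_integral_cong) (auto split: split_indicator)
    also have "\<dots> = ennreal (exp (- c * norm x ^ \<nu>) * q x)"
      by (simp add: nn_integral_cmult nn_integral_exp_tail ennreal_mult' nonneg mult_ac)
    finally show "ennreal (exp (- c * norm x ^ \<nu>) * q x) =
        (\<integral>\<^sup>+t. ennreal (q x) * ennreal (exp (- t)) * ?I x t \<partial>lborel)" ..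
  qed
  also have "\<dots> = (\<integral>\<^sup>+t. \<integral>\<^sup>+x. ennreal (q x) * ennreal (exp (- t)) * ?I x t \<partial>lborel \<partial>lborel)"
    by (rule lborel_pair.Fubini') (use meas in measurable)
  also have "\<dots> = (\<integral>\<^sup>+t. ennreal (indicator {0..} t * t powr (real ?n / \<nu> + 1 - 1) / exp t) *
      (ennreal (c powr (- real ?n / \<nu>)) * ?H) \<partial>lborel)"
    by (intro nn_integral_cong_AE eventually_mono[OF AE_lborel_singleton[of 0]] inner)
  also have "\<dots> = ennreal (Gamma (real ?n / \<nu> + 1)) * (ennreal (c powr (- real ?n / \<nu>)) * ?H)"
    using n by (subst nn_integral_multc) (auto simp: Gamma_conv_nn_integral_real add_nonneg_pos)
  also have "\<dots> = ennreal (Gamma (real ?n / \<nu> + 1) * c powr (- real ?n / \<nu>)) * ?H"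
    by (simp add: ennreal_mult'' mult.assoc)
  finally show ?thesis .
qed

section \<open>The sphere weight as a quotient of Gamma values\<close>

lemma double_fact_rec: "0 < n \<Longrightarrow> double_fact n = nat n * double_fact (n - 2)"
  by (subst double_fact.simps) simp

lemma double_fact_nonpos: "n \<le> 0 \<Longrightarrow> double_fact n = 1"
  by (subst double_fact.simps) simp

lemma Gamma_half_odd: "Gamma (real b + 1 / 2) = sqrt pi * real (double_fact (2 * int b - 1)) / 2 ^ b"
proof (induction b)
  case 0
  then show ?case by (simp add: double_fact_nonpos Gamma_one_half_real)
next
  case (Suc b)
  have "Gamma (real (Suc b) + 1 / 2) = (real b + 1 / 2) * Gamma (real b + 1 / 2)"
    using Gamma_plus1[of "real b + 1 / 2"] nonpos_Ints_nonpos[of "real b + 1 / 2"]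
    by (force simp: add_ac)
  also have "\<dots> = sqrt pi * ((2 * real b + 1) * real (double_fact (2 * int b - 1))) / 2 ^ Suc b"
    unfolding Suc by (simp add: field_simps)
  also have "(2 * real b + 1) * real (double_fact (2 * int b - 1)) =
      real (double_fact (2 * int (Suc b) - 1))"
    by (subst (2) double_fact_rec) (auto simp: nat_add_distrib nat_mult_distrib algebra_simps)
  finally show ?case .
qed

lemma double_fact_even: "double_fact (2 * int b) = 2 ^ b * fact b"
proof (induction b)
  case 0
  then show ?case by (simp add: double_fact_nonpos)
next
  case (Suc b)
  have "double_fact (2 * int (Suc b)) = (2 * b + 2) * double_fact (2 * int b)"
    by (subst double_fact_rec) (auto simp: nat_add_distrib nat_mult_distrib)
  then show ?case using Suc by (simp add: algebra_simps)
qed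

lemma double_fact_pos: "0 < double_fact n"
proof (induction n rule: double_fact.induct)
  case (1 n)
  then show ?case by (subst double_fact.simps) auto
qed

lemma sphere_weight_nonneg: "0 \<le> sphere_weight \<alpha>"
  unfolding sphere_weight_def sphere_const_def by (intro mult_nonneg_nonneg divide_nonneg_nonneg of_nat_0_le_iff) auto

text \<open>
  The right-hand side is the classical value of the integral of the monomial over the unit sphere.
  Each factor \<open>(\<alpha>\<^sub>p - 1)!!\<close> comes from a Gamma value at a half-integer.  The denominator is a Gamma
  value at an integer or at a half-integer according to the parity of the dimension, which is
  what the constant \<open>sphere_const\<close> compensates.
\<close>
lemma sphere_weight_Gamma:
  fixes \<alpha> :: "('d::finite) multi_index"
  assumes "\<And>p. even (\<alpha> $ p)"
  shows "sphere_weight \<alpha> =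
    2 * (\<Prod>p\<in>UNIV. Gamma ((real (\<alpha> $ p) + 1) / 2)) / Gamma (real (CARD('d) + mi_size \<alpha>) / 2)"
proof -
  let ?d = "CARD('d)"
  define b where "b p = \<alpha> $ p div 2" for p
  define B where "B = (\<Sum>p\<in>UNIV. b p)"
  have b: "\<alpha> $ p = 2 * b p" for p using assms by (simp add: b_def)
  have B: "mi_size \<alpha> = 2 * B" by (simp add: mi_size_def b B_def sum_distrib_left)
  have prod: "(\<Prod>p\<in>UNIV. Gamma ((real (\<alpha> $ p) + 1) / 2)) =
      sqrt pi ^ ?d * real (\<Prod>p\<in>UNIV. double_fact (int (\<alpha> $ p) - 1)) / 2 ^ B"
  proof -
    have "(real (\<alpha> $ p) + 1) / 2 = real (b p) + 1 / 2" for p by (simp add: b add_divide_distrib)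
    then have "(\<Prod>p\<in>UNIV. Gamma ((real (\<alpha> $ p) + 1) / 2)) =
        (\<Prod>p\<in>UNIV. sqrt pi * real (double_fact (int (\<alpha> $ p) - 1)) / 2 ^ b p)"
      by (intro prod.cong refl) (simp only: Gamma_half_odd, simp add: b)
    then show ?thesis
      by (simp add: prod_dividef prod.distrib B_def power_sum)
  qed
  have ev: "of_bool (\<forall>p. even (\<alpha> $ p)) = (1 :: real)" using assms by simp
  have "(2 * pi) powr (real ?d / 2) * sphere_const ?d /
      real (double_fact (int (mi_size \<alpha>) + int ?d - 2)) =
      2 * (sqrt pi ^ ?d / 2 ^ B) / Gamma (real (?d + mi_size \<alpha>) / 2)"
  proof (cases "even ?d")
    case True
    then obtain e where e: "?d = 2 * e" by auto
    have "?d > 0" by simp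
    then obtain e' where e': "e = Suc e'" using e by (cases e) auto
    have 1: "real (?d + mi_size \<alpha>) / 2 = 1 + real (B + e')" using e e' B by simp
    have 2: "int (mi_size \<alpha>) + int ?d - 2 = 2 * int (B + e')" using e e' B by simp
    have 3: "(2 * pi) powr (real ?d / 2) = 2 ^ e * pi ^ e"
      by (simp add: e powr_realpow power_mult_distrib)
    have 4: "sqrt pi ^ ?d = pi ^ e" by (simp add: e power_mult)
    show ?thesis unfolding 1 2 3 4 double_fact_even Gamma_fact
      using True by (simp add: sphere_const_def e' power_add field_simps)
  next
    case False
    then obtain e where e: "?d = 2 * e + 1" by (metis oddE)
    have 1: "real (?d + mi_size \<alpha>) / 2 = real (B + e) + 1 / 2" using e B by simp
    have 2: "int (mi_size \<alpha>) + int ?d - 2 = 2 * int (B + e) - 1" using e B by simp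
    have 3: "(2 * pi) powr (real ?d / 2) = 2 ^ e * pi ^ e * (sqrt 2 * sqrt pi)"
    proof -
      have "real ?d / 2 = real e + 1 / 2" using e by simp
      then have "(2 * pi) powr (real ?d / 2) = (2 * pi) ^ e * sqrt (2 * pi)"
        by (simp only: powr_add) (simp add: powr_half_sqrt powr_realpow)
      then show ?thesis by (simp add: power_mult_distrib real_sqrt_mult)
    qed
    have 4: "sqrt pi ^ ?d = pi ^ e * sqrt pi" by (simp add: e power_mult)
    have 5: "sphere_const ?d * sqrt 2 = 2 / sqrt pi"
      using False by (simp add: sphere_const_def real_sqrt_divide)
    have "real (double_fact (2 * int (B + e) - 1)) \<noteq> 0" using double_fact_pos by (metis less_numeral_extra(3) of_nat_0_eq_iff)
    then have "(2 * pi) powr (real ?d / 2) * sphere_const ?d / real (double_fact (2 * int (B + e) - 1)) =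
       2 ^ e * pi ^ e * sqrt pi * (2 / sqrt pi) / real (double_fact (2 * int (B + e) - 1))"
      unfolding 3 5[symmetric] by (simp add: mult_ac)
    then show ?thesis unfolding 1 2 4 Gamma_half_odd
      using False by (simp add: power_add field_simps)
  qed
  then have "(2 * pi) powr (real ?d / 2) * sphere_const ?d /
      real (double_fact (int (mi_size \<alpha>) + int ?d - 2)) * real (\<Prod>p\<in>UNIV. double_fact (int (\<alpha> $ p) - 1)) =
      2 * (sqrt pi ^ ?d / 2 ^ B) / Gamma (real (?d + mi_size \<alpha>) / 2) * real (\<Prod>p\<in>UNIV. double_fact (int (\<alpha> $ p) - 1))"
    by simp
  then show ?thesis unfolding sphere_weight_def prod ev by (simp add: mult_ac)
qed

section \<open>Monomials over the unit ball\<close>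

lemma mi_power_add: "mi_power x (\<alpha> + \<beta>) = mi_power x \<alpha> * mi_power x \<beta>"
  by (simp add: mi_power_def power_add prod.distrib)

lemma mi_size_add: "mi_size (\<alpha> + \<beta>) = mi_size \<alpha> + mi_size \<beta>"
  by (simp add: mi_size_def sum.distrib)

lemma mi_power_scale: "mi_power (s *\<^sub>R x) \<alpha> = s ^ mi_size \<alpha> * mi_power x \<alpha>"
  by (simp add: mi_power_def mi_size_def power_mult_distrib prod.distrib power_sum)

lemma mi_power_measurable [measurable]: "(\<lambda>x. mi_power x \<alpha>) \<in> borel_measurable borel"
  unfolding mi_power_def
  by (intro borel_measurable_continuous_onI continuous_intros)

lemma abs_mi_power_le: "\<bar>mi_power x \<alpha>\<bar> \<le> norm x ^ mi_size \<alpha>"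
  unfolding mi_power_def mi_size_def abs_prod power_sum
  by (intro prod_mono) (auto simp: power_abs intro!: power_mono component_le_norm_cart)

lemma Basis_vec_real: "(Basis :: (real ^ 'd) set) = range (\<lambda>p. axis p 1)"
  by (auto simp: Basis_vec_def)

lemma prod_Basis_vec: "(\<Prod>b\<in>(Basis :: (real ^ 'd) set). h b) = (\<Prod>p\<in>UNIV. h (axis p 1))"
  unfolding Basis_vec_real by (subst prod.reindex) (auto simp: inj_on_def axis_eq_axis)

text \<open>
  Transfers the factorisation of integrals over a Euclidean space from products over the basis to
  products over the coordinates.
\<close>
lemma nn_integral_lborel_prod_vec:
  fixes f :: "'d::finite \<Rightarrow> real \<Rightarrow> ennreal"
  assumes [measurable]: "\<And>p. f p \<in> borel_measurable borel"
  shows "(\<integral>\<^sup>+x. (\<Prod>p\<in>UNIV. f p (x $ p)) \<partial>lborel) = (\<Prod>p\<in>UNIV. \<integral>\<^sup>+t. f p t \<partial>lborel)"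
proof -
  define h where "h b = f (THE p. b = axis p (1::real))" for b :: "real ^ 'd"
  have h: "h (axis p 1) = f p" for p by (simp add: h_def axis_eq_axis)
  have "(\<integral>\<^sup>+x. (\<Prod>b\<in>Basis. h b (x \<bullet> b)) \<partial>lborel) = (\<Prod>b\<in>Basis. \<integral>\<^sup>+t. h b t \<partial>lborel)"
    by (rule nn_integral_lborel_prod) (auto simp: Basis_vec_real h)
  then show ?thesis by (simp add: prod_Basis_vec h inner_axis)
qed

text \<open>
  The one-dimensional case of \<open>nn_integral_exp_norm_homogeneous\<close> with \<open>\<nu> = 2\<close>: the unit ball is
  \<open>{-1..1}\<close>, where the power of \<open>\<bar>t\<bar>\<close> has an elementary integral.
\<close>
lemma nn_integral_gaussian_abs_power:
  "(\<integral>\<^sup>+t. ennreal (exp (- t\<^sup>2) * \<bar>t\<bar> ^ a) \<partial>lborel) = ennreal (Gamma ((real a + 1) / 2))"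
proof -
  have *: "(\<integral>\<^sup>+t. ennreal (\<bar>t\<bar> ^ a) * indicator (cball 0 1) t \<partial>lborel) = ennreal (2 / (real a + 1))"
  proof -
    have "(\<integral>\<^sup>+t. ennreal (\<bar>t\<bar> ^ a) * indicator (cball 0 1) t \<partial>lborel) =
       (\<integral>\<^sup>+t. ennreal (\<bar>t\<bar> ^ a) * indicator {0..1} t + ennreal (\<bar>t\<bar> ^ a) * indicator {-1..<0} t \<partial>lborel)"
      by (intro nn_integral_cong) (auto split: split_indicator)
    also have "\<dots> = (\<integral>\<^sup>+t. ennreal (\<bar>t\<bar> ^ a) * indicator {0..1} t \<partial>lborel) +
        (\<integral>\<^sup>+t. ennreal (\<bar>t\<bar> ^ a) * indicator {-1..<0} t \<partial>lborel)"
      by (intro nn_integral_add) auto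
    also have "(\<integral>\<^sup>+t. ennreal (\<bar>t\<bar> ^ a) * indicator {-1..<0} t \<partial>lborel) =
        (\<integral>\<^sup>+t. ennreal (\<bar>t\<bar> ^ a) * indicator {0..1} t \<partial>lborel)"
    proof (subst nn_integral_real_affine[where c = "-1" and t = 0])
      have "(\<integral>\<^sup>+t. ennreal (\<bar>t\<bar> ^ a) * indicator {-1..<0} (- t) \<partial>lborel) =
        (\<integral>\<^sup>+t. ennreal (\<bar>t\<bar> ^ a) * indicator {0..1} t \<partial>lborel)"
        by (intro nn_integral_cong_AE eventually_mono[OF AE_lborel_singleton[of 0]])
           (auto split: split_indicator)
      then show "ennreal \<bar>- 1\<bar> * (\<integral>\<^sup>+t. ennreal (\<bar>0 + - 1 * t\<bar> ^ a) * indicator {-1..<0} (0 + - 1 * t) \<partial>lborel) =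
        (\<integral>\<^sup>+t. ennreal (\<bar>t\<bar> ^ a) * indicator {0..1} t \<partial>lborel)" by simp
    qed auto
    also have "(\<integral>\<^sup>+t. ennreal (\<bar>t\<bar> ^ a) * indicator {0..1} t \<partial>lborel) =
        (\<integral>\<^sup>+t. ennreal (t ^ a) * indicator {0..1} t \<partial>lborel)"
      by (intro nn_integral_cong) (auto split: split_indicator)
    also have "\<dots> = ennreal (1 ^ Suc a / Suc a - 0 ^ Suc a / Suc a)"
      by (rule nn_integral_FTC_Icc) (auto intro!: derivative_eq_intros simp del: of_nat_Suc power_Suc)
    finally show ?thesis by (simp flip: ennreal_plus add: field_simps)
  qed
  have "(\<integral>\<^sup>+t. ennreal (exp (- 1 * norm t ^ 2) * \<bar>t\<bar> ^ a) \<partial>lborel) =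
     ennreal (Gamma (real (DIM(real) + a) / real 2 + 1) * 1 powr (- real (DIM(real) + a) / real 2)) *
         (\<integral>\<^sup>+x. ennreal (\<bar>x\<bar> ^ a) * indicator (cball 0 1) x \<partial>lborel)"
    by (rule nn_integral_exp_norm_homogeneous) (auto simp: abs_mult power_mult_distrib)
  also have "\<dots> = ennreal (Gamma ((real a + 1) / 2 + 1) * (2 / (real a + 1)))"
    unfolding * by (subst ennreal_mult'') (auto simp: add_ac)
  also have "Gamma ((real a + 1) / 2 + 1) = (real a + 1) / 2 * Gamma ((real a + 1) / 2)"
    using Gamma_plus1[of "(real a + 1) / 2"] nonpos_Ints_nonpos[of "(real a + 1) / 2"] by force
  finally show ?thesis by (simp add: field_simps)
qed

text \<open>
  The integral of the monomial against \<open>exp (- (norm x)\<^sup>2)\<close> is computed in two ways: as a product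
  over the coordinates, and by \<open>nn_integral_exp_norm_homogeneous\<close> with \<open>\<nu> = 2\<close> as a Gamma value
  times the unknown integral over the ball.
\<close>
lemma nn_integral_mi_power_cball:
  fixes \<alpha> :: "('d::finite) multi_index"
  assumes "\<And>p. even (\<alpha> $ p)"
  shows "(\<integral>\<^sup>+x. ennreal (mi_power x \<alpha>) * indicator (cball 0 1) x \<partial>lborel) =
         ennreal (sphere_weight \<alpha> / real (CARD('d) + mi_size \<alpha>))"
proof -
  let ?n = "CARD('d) + mi_size \<alpha>"
  let ?H = "\<integral>\<^sup>+x. ennreal (mi_power x \<alpha>) * indicator (cball 0 1) x \<partial>lborel"
  let ?P = "\<Prod>p\<in>UNIV. Gamma ((real (\<alpha> $ p) + 1) / 2)"
  have abs: "mi_power x \<alpha> = (\<Prod>p\<in>UNIV. \<bar>x $ p\<bar> ^ (\<alpha> $ p))" for x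
    by (simp add: mi_power_def power_even_abs assms)
  have nonneg: "0 \<le> mi_power x \<alpha>" for x
    unfolding abs by (intro prod_nonneg) auto
  have "(\<integral>\<^sup>+x. ennreal (exp (- 1 * norm x ^ 2) * mi_power x \<alpha>) \<partial>lborel) =
        (\<integral>\<^sup>+x. (\<Prod>p\<in>UNIV. ennreal (exp (- (x $ p)\<^sup>2) * \<bar>x $ p\<bar> ^ (\<alpha> $ p))) \<partial>lborel)"
  proof (intro nn_integral_cong)
    fix x :: "real ^ 'd"
    have "exp (- 1 * norm x ^ 2) = (\<Prod>p\<in>UNIV. exp (- (x $ p)\<^sup>2))"
      by (simp add: norm_vec_def L2_set_def sum_nonneg exp_sum flip: sum_negf)
    then show "ennreal (exp (- 1 * norm x ^ 2) * mi_power x \<alpha>) =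
        (\<Prod>p\<in>UNIV. ennreal (exp (- (x $ p)\<^sup>2) * \<bar>x $ p\<bar> ^ (\<alpha> $ p)))"
      by (simp add: abs prod_ennreal prod.distrib)
  qed
  also have "\<dots> = (\<Prod>p\<in>UNIV. ennreal (Gamma ((real (\<alpha> $ p) + 1) / 2)))"
    by (subst nn_integral_lborel_prod_vec) (auto simp: nn_integral_gaussian_abs_power)
  also have "\<dots> = ennreal ?P"
    by (intro prod_ennreal Gamma_real_nonneg) simp
  finally have 1: "ennreal ?P = (\<integral>\<^sup>+x. ennreal (exp (- 1 * norm x ^ 2) * mi_power x \<alpha>) \<partial>lborel)" ..
  also have "\<dots> = ennreal (Gamma (real (DIM(real ^ 'd) + mi_size \<alpha>) / real 2 + 1) *
       1 powr (- real (DIM(real ^ 'd) + mi_size \<alpha>) / real 2)) * ?H"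
    by (rule nn_integral_exp_norm_homogeneous) (auto simp: mi_power_scale nonneg)
  finally have eq: "ennreal ?P = ennreal (Gamma (real ?n / 2 + 1)) * ?H" by simp
  have "0 < ?n" by simp
  then have n: "0 < real ?n" by (simp only: of_nat_0_less_iff)
  have pos: "0 < Gamma (real ?n / 2)" "0 < real ?n"
    using n by (auto intro!: Gamma_real_pos simp del: of_nat_add)
  have G: "Gamma (real ?n / 2 + 1) = real ?n / 2 * Gamma (real ?n / 2)"
    using Gamma_plus1[of "real ?n / 2"] nonpos_Ints_nonpos[of "real ?n / 2"] pos by force
  have "?P = Gamma (real ?n / 2 + 1) * (sphere_weight \<alpha> / real ?n)"
  proof -
    have "P = n / 2 * G * (2 * P / G / n)" if "0 < G" "0 < n" for n G P :: real
      using that by simp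
    then show ?thesis unfolding G sphere_weight_Gamma[OF assms] using pos by blast
  qed
  then have "ennreal (Gamma (real ?n / 2 + 1)) * ennreal (sphere_weight \<alpha> / real ?n) =
      ennreal (Gamma (real ?n / 2 + 1)) * ?H"
    using eq by (simp only: ennreal_mult''[OF divide_nonneg_nonneg[OF sphere_weight_nonneg of_nat_0_le_iff]])
  moreover have "0 < Gamma (real ?n / 2 + 1)" using pos by (simp only: G) simp
  ultimately show ?thesis
    by (subst (asm) ennreal_mult_cancel_left) auto
qed

section \<open>Moments of the radial exponential\<close>

text \<open>
  Only the power of \<open>c\<close> matters for error terms, so the constant is left unspecified.
\<close>
lemma integral_exp_norm_power:
  assumes "1 \<le> \<nu>"
  obtains K where "\<And>c. 0 < c \<Longrightarrow> has_bochner_integral lborel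
    (\<lambda>x :: 'a::euclidean_space. exp (- c * norm x ^ \<nu>) * norm x ^ p) (K * c powr (- real (DIM('a) + p) / \<nu>))"
proof -
  let ?H = "\<integral>\<^sup>+x. ennreal (norm (x :: 'a) ^ p) * indicator (cball 0 1) x \<partial>lborel"
  have "?H \<le> (\<integral>\<^sup>+x. indicator (cball 0 1) (x :: 'a) \<partial>lborel)"
    by (intro nn_integral_mono) (auto split: split_indicator simp: power_le_one)
  also have "\<dots> < \<infinity>"
    using emeasure_bounded_finite[of "cball 0 1"] by simp
  finally obtain H where H: "?H = ennreal H" "0 \<le> H"
    by (cases ?H) auto
  have "has_bochner_integral lborel (\<lambda>x :: 'a. exp (- c * norm x ^ \<nu>) * norm x ^ p)
      (Gamma (real (DIM('a) + p) / \<nu> + 1) * H * c powr (- real (DIM('a) + p) / \<nu>))" if "0 < c" for c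
  proof (rule has_bochner_integral_nn_integral)
    have G: "0 < Gamma (real (DIM('a) + p) / \<nu> + 1)"
      by (intro Gamma_real_pos add_nonneg_pos) auto
    then show "0 \<le> Gamma (real (DIM('a) + p) / \<nu> + 1) * H * c powr (- real (DIM('a) + p) / \<nu>)"
      using H(2) by simp
    have "(\<integral>\<^sup>+x. ennreal (exp (- c * norm (x :: 'a) ^ \<nu>) * norm x ^ p) \<partial>lborel) =
      ennreal (Gamma (real (DIM('a) + p) / \<nu> + 1) * c powr (- real (DIM('a) + p) / \<nu>)) * ?H"
      using that assms by (intro nn_integral_exp_norm_homogeneous) (auto simp: power_mult_distrib)
    also have "\<dots> = ennreal (Gamma (real (DIM('a) + p) / \<nu> + 1) * c powr (- real (DIM('a) + p) / \<nu>) * H)"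
      unfolding H(1) by (rule ennreal_mult''[OF H(2), symmetric])
    finally show "(\<integral>\<^sup>+x. ennreal (exp (- c * norm (x :: 'a) ^ \<nu>) * norm x ^ p) \<partial>lborel) =
      ennreal (Gamma (real (DIM('a) + p) / \<nu> + 1) * H * c powr (- real (DIM('a) + p) / \<nu>))"
      by (simp add: mult_ac)
  qed auto
  then show ?thesis using that by blast
qed

definition reflect :: "'d \<Rightarrow> real ^ 'd \<Rightarrow> real ^ 'd" where
  "reflect p x = (\<chi> i. if i = p then - x $ i else x $ i)"

lemma norm_reflect: "norm (reflect p x) = norm x"
  unfolding norm_vec_def reflect_def L2_set_def
  by (intro arg_cong[of _ _ sqrt] sum.cong) auto

lemma mi_power_reflect: "mi_power (reflect p x) \<alpha> = (- 1) ^ (\<alpha> $ p) * mi_power x \<alpha>"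
proof -
  have "mi_power (reflect p x) \<alpha> =
    (\<Prod>i\<in>UNIV. (if i = p then (- 1) ^ (\<alpha> $ p) else 1) * (x $ i) ^ (\<alpha> $ i))"
    unfolding mi_power_def reflect_def
    by (intro prod.cong) (auto simp: power_mult_distrib[symmetric])
  then show ?thesis by (simp add: prod.distrib mi_power_def)
qed

lemma reflect_measurable [measurable]: "reflect p \<in> borel_measurable borel"
proof (rule borel_measurable_continuous_onI)
  have "continuous_on UNIV (\<lambda>x :: real ^ 'a. if i = p then - x $ i else x $ i)" for i
    by (cases "i = p") (auto intro!: continuous_intros)
  then show "continuous_on UNIV (reflect p)"
    unfolding reflect_def by (rule continuous_on_vec_lambda)
qed

lemma distr_lborel_reflect: "distr lborel borel (reflect p) = lborel"
proof -
  define c where "c b = (if b = axis p 1 then - 1 else 1 :: real)" for b :: "real ^ 'a"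
  have T: "0 + (\<Sum>b\<in>Basis. (c b * (x \<bullet> b)) *\<^sub>R b) = reflect p x" for x
  proof -
    have "(\<Sum>b\<in>Basis. (c b * (x \<bullet> b)) *\<^sub>R b) = (\<Sum>i\<in>UNIV. (c (axis i 1) * x $ i) *\<^sub>R axis i 1)"
      unfolding Basis_vec_real
      by (subst sum.reindex) (auto simp: inj_on_def axis_eq_axis inner_axis)
    also have "\<dots> = (\<Sum>i\<in>UNIV. reflect p x $ i *\<^sub>R axis i 1)"
      by (intro sum.cong) (auto simp: c_def axis_eq_axis reflect_def)
    also have "\<dots> = reflect p x"
      using basis_expansion[of "reflect p x"] by (simp add: scalar_mult_eq_scaleR)
    finally show ?thesis by simp
  qed
  have abs: "(\<Prod>b\<in>Basis. \<bar>c b\<bar>) = 1" by (intro prod.neutral) (auto simp: c_def)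
  have "lborel = density (distr lborel borel (\<lambda>x. 0 + (\<Sum>b\<in>Basis. (c b * (x \<bullet> b)) *\<^sub>R b))) (\<lambda>_. (\<Prod>b\<in>Basis. \<bar>c b\<bar>))"
    by (rule lborel_affine_euclidean) (auto simp: c_def)
  then show ?thesis unfolding T abs by (simp add: density_1)
qed

text \<open>
  If all exponents are even the integrand is nonnegative, and the value follows from the integral
  over the unit ball.  If the exponent of some coordinate is odd, reflecting that coordinate changes
  the sign of the integrand, so the integral vanishes, as does the weight.
\<close>
lemma has_bochner_integral_exp_norm_mi_power:
  fixes \<alpha> :: "('d::finite) multi_index"
  assumes "0 < c" and "1 \<le> \<nu>"
  shows "has_bochner_integral lborel (\<lambda>x. exp (- c * norm x ^ \<nu>) * mi_power x \<alpha>)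
    (1 / real \<nu> * Gamma (real (CARD('d) + mi_size \<alpha>) / \<nu>) *
     c powr (- real (CARD('d) + mi_size \<alpha>) / \<nu>) * sphere_weight \<alpha>)"
proof (cases "\<forall>p. even (\<alpha> $ p)")
  case True
  let ?n = "CARD('d) + mi_size \<alpha>"
  have nonneg: "0 \<le> mi_power x \<alpha>" for x
    unfolding mi_power_def using True by (intro prod_nonneg) (auto intro: zero_le_even_power)
  have "0 < ?n" by simp
  then have "0 < real ?n" by (simp only: of_nat_0_less_iff)
  then have n: "0 < real ?n / \<nu>" using \<open>1 \<le> \<nu>\<close> by (simp del: of_nat_add)
  have G: "0 < Gamma (real ?n / \<nu>)" using n by (rule Gamma_real_pos)
  have G1: "Gamma (real ?n / \<nu> + 1) = real ?n / \<nu> * Gamma (real ?n / \<nu>)"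
    using n Gamma_plus1[of "real ?n / \<nu>"] nonpos_Ints_nonpos[of "real ?n / \<nu>"] by force
  note w = sphere_weight_nonneg[of \<alpha>]
  show ?thesis
  proof (rule has_bochner_integral_nn_integral)
    show "0 \<le> 1 / real \<nu> * Gamma (real ?n / \<nu>) * c powr (- real ?n / \<nu>) * sphere_weight \<alpha>"
      using w G by simp
    have "(\<integral>\<^sup>+x. ennreal (exp (- c * norm x ^ \<nu>) * mi_power x \<alpha>) \<partial>lborel) =
      ennreal (Gamma (real (DIM(real ^ 'd) + mi_size \<alpha>) / \<nu> + 1) *
         c powr (- real (DIM(real ^ 'd) + mi_size \<alpha>) / \<nu>)) *
      (\<integral>\<^sup>+x. ennreal (mi_power x \<alpha>) * indicator (cball 0 1) x \<partial>lborel)"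
      using assms by (intro nn_integral_exp_norm_homogeneous) (auto simp: mi_power_scale nonneg)
    also have "\<dots> = ennreal (Gamma (real ?n / \<nu> + 1) * c powr (- real ?n / \<nu>) * (sphere_weight \<alpha> / ?n))"
      unfolding nn_integral_mi_power_cball[OF True[rule_format]]
      by (subst ennreal_mult''[OF divide_nonneg_nonneg[OF w of_nat_0_le_iff]]) simp
    also have "Gamma (real ?n / \<nu> + 1) * c powr (- real ?n / \<nu>) * (sphere_weight \<alpha> / ?n) =
       1 / real \<nu> * Gamma (real ?n / \<nu>) * c powr (- real ?n / \<nu>) * sphere_weight \<alpha>"
      unfolding G1 using n by (simp del: of_nat_add add: divide_simps)
    finally show "(\<integral>\<^sup>+x. ennreal (exp (- c * norm x ^ \<nu>) * mi_power x \<alpha>) \<partial>lborel) =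
      ennreal (1 / real \<nu> * Gamma (real ?n / \<nu>) * c powr (- real ?n / \<nu>) * sphere_weight \<alpha>)" .
  qed (auto simp: nonneg)
next
  case False
  then obtain p where p: "odd (\<alpha> $ p)" by blast
  let ?F = "\<lambda>x. exp (- c * norm x ^ \<nu>) * mi_power x \<alpha>"
  obtain K where "\<And>c. 0 < c \<Longrightarrow> has_bochner_integral lborel
    (\<lambda>x :: real ^ 'd. exp (- c * norm x ^ \<nu>) * norm x ^ mi_size \<alpha>) (K * c powr (- real (DIM(real ^ 'd) + mi_size \<alpha>) / \<nu>))"
    using integral_exp_norm_power[OF \<open>1 \<le> \<nu>\<close>] by blast
  then have "integrable lborel (\<lambda>x :: real ^ 'd. exp (- c * norm x ^ \<nu>) * norm x ^ mi_size \<alpha>)"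
    using \<open>0 < c\<close> has_bochner_integral_iff by blast
  then have int: "integrable lborel ?F"
    by (rule Bochner_Integration.integrable_bound) (auto simp: abs_mult abs_mi_power_le)
  have "integral\<^sup>L lborel ?F = integral\<^sup>L (distr lborel borel (reflect p)) ?F"
    by (simp add: distr_lborel_reflect)
  also have "\<dots> = (\<integral>x. - ?F x \<partial>lborel)"
    using p by (subst integral_distr) (auto simp: norm_reflect mi_power_reflect)
  finally have "integral\<^sup>L lborel ?F = 0" by simp
  moreover have "sphere_weight \<alpha> = 0" using False by (simp add: sphere_weight_def)
  ultimately show ?thesis using int by (simp add: has_bochner_integral_iff)
qed

section \<open>Expansions graded by homogeneous degree\<close>

text \<open>
  The function \<open>A n\<close> stands for the part of degree \<open>s + n\<close>.  Its bound is required on the whole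
  space (the filter \<open>top\<close>), as it holds for homogeneous polynomials and is needed far from the
  origin, whereas \<open>a\<close> is compared with the parts only near \<open>0\<close>.
\<close>
definition graded_expansion :: "nat \<Rightarrow> nat \<Rightarrow> ('a::real_normed_vector \<Rightarrow> real) \<Rightarrow> (nat \<Rightarrow> 'a \<Rightarrow> real) \<Rightarrow> bool" where
  "graded_expansion N s a A \<longleftrightarrow>
     (\<forall>n\<le>N. A n \<in> O[top](\<lambda>x. norm x ^ (s + n))) \<and>
     (\<lambda>x. a x - (\<Sum>n\<le>N. A n x)) \<in> O[at 0](\<lambda>x. norm x ^ (s + N + 1))"

lemma norm_power_bigo_at_0:
  assumes "p \<le> q"
  shows "(\<lambda>x :: 'a::real_normed_vector. norm x ^ q) \<in> O[at 0](\<lambda>x. norm x ^ p)"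
proof (rule bigoI[of _ 1])
  have "\<forall>\<^sub>F x :: 'a in at 0. norm x < 1"
    using eventually_at_ball[of 1 "0 :: 'a" UNIV] by (auto elim: eventually_mono)
  then show "\<forall>\<^sub>F x :: 'a in at 0. norm (norm x ^ q) \<le> 1 * norm (norm x ^ p)"
    by eventually_elim (use assms in \<open>simp add: power_decreasing\<close>)
qed

lemma graded_expansion_partial_bigo:
  assumes "graded_expansion N s a A" and "\<And>n x. n < q \<Longrightarrow> A n x = 0"
  shows "(\<lambda>x. \<Sum>n\<le>N. A n x) \<in> O[at 0](\<lambda>x. norm x ^ (s + q))"
proof (rule big_sum_in_bigo)
  fix n assume n: "n \<in> {..N}"
  show "A n \<in> O[at 0](\<lambda>x. norm x ^ (s + q))"
  proof (cases "n < q")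
    case True
    then have "A n = (\<lambda>x. 0)" using assms(2) by blast
    then show ?thesis by simp
  next
    case False
    have "A n \<in> O[at 0](\<lambda>x. norm x ^ (s + n))"
      using assms(1) n by - (rule landau_o.big.filter_mono[OF top_greatest], auto simp: graded_expansion_def)
    then show ?thesis
      by (rule landau_o.big_trans) (use False in \<open>intro norm_power_bigo_at_0, simp\<close>)
  qed
qed

lemma graded_expansion_bigo:
  assumes "graded_expansion N s a A" and "\<And>n x. n < q \<Longrightarrow> A n x = 0" and "q \<le> N + 1"
  shows "a \<in> O[at 0](\<lambda>x. norm x ^ (s + q))"
proof -
  have "(\<lambda>x. a x - (\<Sum>n\<le>N. A n x)) \<in> O[at 0](\<lambda>x. norm x ^ (s + q))"
    by (rule landau_o.big_trans[OF conjunct2[OF assms(1)[unfolded graded_expansion_def]] norm_power_bigo_at_0])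
       (use assms(3) in simp)
  from sum_in_bigo(1)[OF this graded_expansion_partial_bigo[OF assms(1,2)]]
  show ?thesis by simp
qed

text \<open>
  The parts of the product are the Cauchy products; the products \<open>A i * B j\<close> with
  \<open>i + j > N\<close> go into the remainder.
\<close>
lemma graded_expansion_mult:
  assumes a: "graded_expansion N s a A" and b: "graded_expansion N t b B"
  shows "graded_expansion N (s + t) (\<lambda>x. a x * b x) (\<lambda>n x. \<Sum>i\<le>n. A i x * B (n - i) x)"
proof -
  have A: "A n \<in> O[top](\<lambda>x. norm x ^ (s + n))" and B: "B n \<in> O[top](\<lambda>x. norm x ^ (t + n))"
    if "n \<le> N" for n using a b that by (auto simp: graded_expansion_def)
  have AB: "(\<lambda>x. A i x * B j x) \<in> O[top](\<lambda>x. norm x ^ (s + t + (i + j)))" if "i \<le> N" "j \<le> N" for i j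
    using landau_o.big.mult[OF A[OF that(1)] B[OF that(2)]] by (simp add: power_add mult_ac)
  have 1: "(\<lambda>x. (a x - (\<Sum>n\<le>N. A n x)) * b x) \<in> O[at 0](\<lambda>x. norm x ^ (s + t + N + 1))"
    using landau_o.big.mult[OF conjunct2[OF a[unfolded graded_expansion_def]] graded_expansion_bigo[OF b, of 0]]
    by (simp add: power_add mult_ac)
  have 2: "(\<lambda>x. (\<Sum>n\<le>N. A n x) * (b x - (\<Sum>n\<le>N. B n x))) \<in> O[at 0](\<lambda>x. norm x ^ (s + t + N + 1))"
    using landau_o.big.mult[OF graded_expansion_partial_bigo[OF a, of 0] conjunct2[OF b[unfolded graded_expansion_def]]]
    by (simp add: power_add mult_ac)
  let ?J = "{(i, j). i \<le> N \<and> j \<le> N \<and> N < i + j}"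
  have 3: "(\<lambda>x. \<Sum>(i, j)\<in>?J. A i x * B j x) \<in> O[at 0](\<lambda>x. norm x ^ (s + t + N + 1))"
  proof (rule big_sum_in_bigo)
    fix z assume "z \<in> ?J"
    then obtain i j where z: "z = (i, j)" "i \<le> N" "j \<le> N" "N + 1 \<le> i + j" by auto
    have "(\<lambda>x. A i x * B j x) \<in> O[at 0](\<lambda>x. norm x ^ (s + t + (i + j)))"
      by (rule landau_o.big.filter_mono[OF top_greatest AB[OF z(2,3)]])
    then show "(\<lambda>x. case z of (i, j) \<Rightarrow> A i x * B j x) \<in> O[at 0](\<lambda>x. norm x ^ (s + t + N + 1))"
      unfolding z prod.case by (rule landau_o.big_trans) (use z in \<open>intro norm_power_bigo_at_0, simp\<close>)
  qed
  have split: "(\<Sum>n\<le>N. A n x) * (\<Sum>n\<le>N. B n x) =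
      (\<Sum>n\<le>N. \<Sum>i\<le>n. A i x * B (n - i) x) + (\<Sum>(i, j)\<in>?J. A i x * B j x)" for x
  proof -
    have "(\<Sum>n\<le>N. A n x) * (\<Sum>n\<le>N. B n x) = (\<Sum>(i, j)\<in>{..N} \<times> {..N}. A i x * B j x)"
      by (simp add: sum_product sum.cartesian_product)
    also have "{..N} \<times> {..N} = {(i, j). i + j \<le> N} \<union> ?J" by auto
    also have "(\<Sum>(i, j)\<in>\<dots>. A i x * B j x) =
        (\<Sum>(i, j)\<in>{(i, j). i + j \<le> N}. A i x * B j x) + (\<Sum>(i, j)\<in>?J. A i x * B j x)"
    proof (rule sum.union_disjoint)
      show "finite {(i, j). i + j \<le> N}" by (rule finite_subset[of _ "{..N} \<times> {..N}"]) auto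
      show "finite ?J" by (rule finite_subset[of _ "{..N} \<times> {..N}"]) auto
    qed auto
    finally show ?thesis by (simp add: sum.triangle_reindex_eq)
  qed
  have "(\<lambda>x. a x * b x - (\<Sum>n\<le>N. \<Sum>i\<le>n. A i x * B (n - i) x)) =
      (\<lambda>x. (a x - (\<Sum>n\<le>N. A n x)) * b x + (\<Sum>n\<le>N. A n x) * (b x - (\<Sum>n\<le>N. B n x)) +
         (\<Sum>(i, j)\<in>?J. A i x * B j x))"
    using split by (auto simp: fun_eq_iff algebra_simps)
  then have "(\<lambda>x. a x * b x - (\<Sum>n\<le>N. \<Sum>i\<le>n. A i x * B (n - i) x)) \<in>
      O[at 0](\<lambda>x. norm x ^ (s + t + N + 1))"
    using sum_in_bigo(1)[OF sum_in_bigo(1)[OF 1 2] 3] by simp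
  moreover have "(\<lambda>x. \<Sum>i\<le>n. A i x * B (n - i) x) \<in> O[top](\<lambda>x. norm x ^ (s + t + n))" if "n \<le> N" for n
  proof (rule big_sum_in_bigo)
    fix i assume "i \<in> {..n}"
    then show "(\<lambda>x. A i x * B (n - i) x) \<in> O[top](\<lambda>x. norm x ^ (s + t + n))"
      using AB[of i "n - i"] that by simp
  qed
  ultimately show ?thesis by (simp add: graded_expansion_def)
qed

lemma finite_compositions: "finite (compositions r m)"
proof (rule finite_subset)
  show "compositions r m \<subseteq> {ns. set ns \<subseteq> {..m} \<and> length ns = r}"
    using member_le_sum_list by (auto simp: compositions_def)
qed (rule finite_lists_length_eq, simp)

lemma compositions_0: "compositions 0 m = (if m = 0 then {[]} else {})"
  by (auto simp: compositions_def)

lemma compositions_Suc: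
  "compositions (Suc r) m = (\<lambda>(n, ns). n # ns) ` (SIGMA n:{1..m}. compositions r (m - n))"
proof (intro equalityI subsetI)
  fix xs assume "xs \<in> compositions (Suc r) m"
  then obtain n ns where "xs = n # ns" "length ns = r" "1 \<le> n" "\<forall>k\<in>set ns. 1 \<le> k" "n + sum_list ns = m"
    by (auto simp: compositions_def length_Suc_conv)
  then show "xs \<in> (\<lambda>(n, ns). n # ns) ` (SIGMA n:{1..m}. compositions r (m - n))"
    by (intro image_eqI[of _ _ "(n, ns)"]) (auto simp: compositions_def)
qed (auto simp: compositions_def)

lemma compositions_eq_empty: "m < r \<Longrightarrow> compositions r m = {}"
proof (induction r arbitrary: m)
  case (Suc r)
  then show ?case by (auto simp: compositions_Suc)
qed simp

text \<open>
  This recursion says that sums over compositions are iterated Cauchy products.  The assumption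
  \<open>a 0 = 0\<close> reflects that the parts of a composition are positive.
\<close>
lemma sum_compositions_Suc:
  fixes a :: "nat \<Rightarrow> real"
  assumes "a 0 = 0"
  shows "(\<Sum>ns\<in>compositions (Suc r) m. \<Prod>i<Suc r. a (ns ! i)) =
    (\<Sum>n\<le>m. a n * (\<Sum>ns\<in>compositions r (m - n). \<Prod>i<r. a (ns ! i)))"
proof -
  have "(\<Sum>ns\<in>compositions (Suc r) m. \<Prod>i<Suc r. a (ns ! i)) =
    (\<Sum>(n, ns)\<in>(SIGMA n:{1..m}. compositions r (m - n)). a n * (\<Prod>i<r. a (ns ! i)))"
    unfolding compositions_Suc
    by (subst sum.reindex) (auto simp: inj_on_def prod.lessThan_Suc_shift intro!: sum.cong simp del: prod.lessThan_Suc)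
  also have "\<dots> = (\<Sum>n\<in>{1..m}. \<Sum>ns\<in>compositions r (m - n). a n * (\<Prod>i<r. a (ns ! i)))"
    by (subst sum.Sigma) (auto simp: finite_compositions)
  also have "\<dots> = (\<Sum>n\<le>m. \<Sum>ns\<in>compositions r (m - n). a n * (\<Prod>i<r. a (ns ! i)))"
    by (rule sum.mono_neutral_left) (auto simp: assms not_less_eq_eq)
  finally show ?thesis by (simp add: sum_distrib_left)
qed

lemma graded_expansion_power:
  assumes "graded_expansion N s a A" and "\<And>x. A 0 x = 0"
  shows "graded_expansion N (r * s) (\<lambda>x. a x ^ r) (\<lambda>m x. \<Sum>ns\<in>compositions r m. \<Prod>i<r. A (ns ! i) x)"
proof (induction r)
  case 0
  have "(\<lambda>x :: 'a. \<Sum>ns\<in>compositions 0 n. \<Prod>i<0. A (ns ! i) x) \<in> O[top](\<lambda>x. norm x ^ n)" for n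
    by (cases "n = 0") (auto simp: compositions_0)
  moreover have "(\<Sum>n\<le>N. \<Sum>ns\<in>compositions 0 n. \<Prod>i<0. A (ns ! i) x) = 1" for x
  proof -
    have "(\<Sum>n\<le>N. \<Sum>ns\<in>compositions 0 n. \<Prod>i<0. A (ns ! i) x) = (\<Sum>n\<le>N. if n = 0 then 1 else 0)"
      by (intro sum.cong) (auto simp: compositions_0)
    then show ?thesis by (simp add: sum.delta)
  qed
  ultimately show ?case by (simp add: graded_expansion_def)
next
  case (Suc r)
  show ?case
    using graded_expansion_mult[OF assms(1) Suc]
    unfolding sum_compositions_Suc[of "\<lambda>n. A n _", OF assms(2)] by (simp add: add_ac)
qed

section \<open>Homogeneous Taylor parts and the algebra of the coefficients\<close>

definition hom_part :: "(('d::finite) multi_index \<Rightarrow> real) \<Rightarrow> nat \<Rightarrow> real ^ 'd \<Rightarrow> real" where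
  "hom_part a n x = (\<Sum>\<alpha> | mi_size \<alpha> = n. a \<alpha> * mi_power x \<alpha>)"

lemma finite_mi_size_eq: "finite {\<alpha> :: ('d::finite) multi_index. mi_size \<alpha> = n}"
  by (rule finite_subset[OF _ finite_mi_size_le[of n]]) auto

lemma hom_part_bigo: "hom_part a n \<in> O[top](\<lambda>x. norm x ^ n)"
  unfolding hom_part_def[abs_def]
proof (rule big_sum_in_bigo)
  fix \<alpha> :: "'a multi_index" assume "\<alpha> \<in> {\<alpha>. mi_size \<alpha> = n}"
  then show "(\<lambda>x. a \<alpha> * mi_power x \<alpha>) \<in> O[top](\<lambda>x. norm x ^ n)"
    by (intro bigoI[of _ "\<bar>a \<alpha>\<bar>"]) (auto simp: abs_mult intro!: mult_left_mono abs_mi_power_le)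
qed

text \<open>
  Groups a Taylor polynomial into its homogeneous parts.
\<close>
lemma sum_mi_size_split:
  fixes h :: "('d::finite) multi_index \<Rightarrow> real"
  shows "(\<Sum>\<alpha> | n \<le> mi_size \<alpha> \<and> mi_size \<alpha> \<le> N + n. h \<alpha>) = (\<Sum>k\<le>N. \<Sum>\<alpha> | mi_size \<alpha> = k + n. h \<alpha>)"
proof -
  have "(\<Sum>k\<le>N. sum h {\<alpha>. mi_size \<alpha> = k + n}) = sum h (\<Union>k\<le>N. {\<alpha>. mi_size \<alpha> = k + n})"
    by (intro sum.UNION_disjoint[symmetric]) (auto simp: finite_mi_size_eq)
  also have "(\<Union>k\<le>N. {\<alpha> :: 'd multi_index. mi_size \<alpha> = k + n}) = {\<alpha>. n \<le> mi_size \<alpha> \<and> mi_size \<alpha> \<le> N + n}"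
    by (auto dest!: le_Suc_ex)
  finally show ?thesis ..
qed

text \<open>
  Expands a product of sums into a sum over lists of choices, one choice for each factor.
\<close>
lemma prod_sum_lists:
  fixes h :: "'a \<Rightarrow> real"
  shows "(\<Prod>i<length ns. \<Sum>y\<in>S (ns ! i). h y) =
    (\<Sum>ys | length ys = length ns \<and> (\<forall>i<length ns. ys ! i \<in> S (ns ! i)). \<Prod>i<length ns. h (ys ! i))"
proof (induction ns)
  case Nil
  have "{ys :: 'a list. length ys = length [] \<and> (\<forall>i<length []. ys ! i \<in> S ([] ! i))} = {[]}" by auto
  then show ?case by simp
next
  case (Cons n ns)
  let ?L = "\<lambda>ns. {ys. length ys = length ns \<and> (\<forall>i<length ns. ys ! i \<in> S (ns ! i))}"
  have L: "?L (n # ns) = (\<lambda>(y, ys). y # ys) ` (S n \<times> ?L ns)"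
  proof (intro equalityI subsetI)
    fix zs assume zs: "zs \<in> ?L (n # ns)"
    then obtain y ys where "zs = y # ys" by (auto simp: length_Suc_conv)
    with zs show "zs \<in> (\<lambda>(y, ys). y # ys) ` (S n \<times> ?L ns)"
      by (intro image_eqI[of _ _ "(y, ys)"]) force+
  qed (auto simp: nth_Cons' less_Suc_eq_0_disj)
  have "(\<Prod>i<length (n # ns). \<Sum>y\<in>S ((n # ns) ! i). h y) = (\<Sum>y\<in>S n. h y) * (\<Prod>i<length ns. \<Sum>y\<in>S (ns ! i). h y)"
    by (simp add: prod.lessThan_Suc_shift del: prod.lessThan_Suc)
  also have "\<dots> = (\<Sum>(y, ys)\<in>S n \<times> ?L ns. h y * (\<Prod>i<length ns. h (ys ! i)))"
    by (simp add: Cons sum_product sum.cartesian_product)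
  also have "\<dots> = (\<Sum>ys\<in>?L (n # ns). \<Prod>i<length (n # ns). h (ys ! i))"
    unfolding L by (subst sum.reindex)
      (auto simp: inj_on_def prod.lessThan_Suc_shift intro!: sum.cong simp del: prod.lessThan_Suc)
  finally show ?case .
qed

text \<open>
  For \<open>f\<close> and \<open>g\<close> with Taylor coefficients \<open>a\<close> and \<open>b\<close>, this is the homogeneous part of degree
  \<open>r * \<nu> + j\<close> of \<open>E ^ r * g\<close>, where \<open>E\<close> is \<open>f\<close> without its part of degree \<open>\<nu>\<close>.
\<close>
definition prod_part ::
  "(('d::finite) multi_index \<Rightarrow> real) \<Rightarrow> ('d multi_index \<Rightarrow> real) \<Rightarrow> nat \<Rightarrow> nat \<Rightarrow> nat \<Rightarrow> real ^ 'd \<Rightarrow> real" where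
  "prod_part a b \<nu> r j x =
     (\<Sum>m\<le>j. (\<Sum>ns\<in>compositions r m. \<Prod>i<r. hom_part a (ns ! i + \<nu>) x) * hom_part b (j - m) x)"

lemma mi_power_sum: "mi_power x (\<Sum>i\<in>I. \<alpha> i) = (\<Prod>i\<in>I. mi_power x (\<alpha> i))"
  by (induction I rule: infinite_finite_induct) (auto simp: mi_power_add, simp_all add: mi_power_def)

lemma mi_size_sum: "mi_size (\<Sum>i\<in>I. \<alpha> i) = (\<Sum>i\<in>I. mi_size (\<alpha> i))"
  by (induction I rule: infinite_finite_induct) (auto simp: mi_size_add, simp_all add: mi_size_def)

lemma prod_part_expand:
  "prod_part a b \<nu> r j x =
     (\<Sum>m\<le>j. \<Sum>\<beta> | mi_size \<beta> = j - m. \<Sum>ns\<in>compositions r m.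
        \<Sum>\<alpha>s | length \<alpha>s = r \<and> (\<forall>i<r. mi_size (\<alpha>s ! i) = ns ! i + \<nu>).
          b \<beta> * (\<Prod>i<r. a (\<alpha>s ! i)) * mi_power x (\<beta> + (\<Sum>i<r. \<alpha>s ! i)))"
  unfolding prod_part_def
proof (intro sum.cong refl)
  fix m assume "m \<in> {..j}"
  let ?L = "\<lambda>ns. {\<alpha>s. length \<alpha>s = r \<and> (\<forall>i<r. mi_size (\<alpha>s ! i) = ns ! i + \<nu>)}"
  have *: "(\<Prod>i<r. hom_part a (ns ! i + \<nu>) x) =
      (\<Sum>\<alpha>s\<in>?L ns. (\<Prod>i<r. a (\<alpha>s ! i)) * mi_power x (\<Sum>i<r. \<alpha>s ! i))"
    if "ns \<in> compositions r m" for ns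
  proof -
    have "length ns = r" using that by (simp add: compositions_def)
    then show ?thesis
      using prod_sum_lists[where S = "\<lambda>n. {\<alpha>. mi_size \<alpha> = n + \<nu>}" and h = "\<lambda>\<alpha>. a \<alpha> * mi_power x \<alpha>" and ns = ns]
      by (simp add: hom_part_def prod.distrib mi_power_sum)
  qed
  have "(\<Sum>ns\<in>compositions r m. \<Prod>i<r. hom_part a (ns ! i + \<nu>) x) * hom_part b (j - m) x =
     (\<Sum>ns\<in>compositions r m. \<Sum>\<beta> | mi_size \<beta> = j - m. \<Sum>\<alpha>s\<in>?L ns.
        b \<beta> * (\<Prod>i<r. a (\<alpha>s ! i)) * mi_power x (\<beta> + (\<Sum>i<r. \<alpha>s ! i)))"
    unfolding sum_distrib_right
  proof (intro sum.cong refl)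
    fix ns assume "ns \<in> compositions r m"
    show "(\<Prod>i<r. hom_part a (ns ! i + \<nu>) x) * hom_part b (j - m) x =
      (\<Sum>\<beta> | mi_size \<beta> = j - m. \<Sum>\<alpha>s\<in>?L ns.
        b \<beta> * (\<Prod>i<r. a (\<alpha>s ! i)) * mi_power x (\<beta> + (\<Sum>i<r. \<alpha>s ! i)))"
      unfolding *[OF \<open>ns \<in> compositions r m\<close>] hom_part_def[of b] sum_product
      by (subst sum.swap) (simp add: mi_power_add mult_ac)
  qed
  also have "\<dots> = (\<Sum>\<beta> | mi_size \<beta> = j - m. \<Sum>ns\<in>compositions r m. \<Sum>\<alpha>s\<in>?L ns.
        b \<beta> * (\<Prod>i<r. a (\<alpha>s ! i)) * mi_power x (\<beta> + (\<Sum>i<r. \<alpha>s ! i)))"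
    by (rule sum.swap)
  finally show "(\<Sum>ns\<in>compositions r m. \<Prod>i<r. hom_part a (ns ! i + \<nu>) x) * hom_part b (j - m) x = \<dots>" .
qed

text \<open>
  What \<open>prod_part_expand\<close> turns into when each monomial is replaced by its sphere weight.
\<close>
definition weight_sum ::
  "(('d::finite) multi_index \<Rightarrow> real) \<Rightarrow> ('d multi_index \<Rightarrow> real) \<Rightarrow> nat \<Rightarrow> nat \<Rightarrow> nat \<Rightarrow> nat \<Rightarrow> real" where
  "weight_sum a b \<nu> r j m =
     (\<Sum>\<beta> | mi_size \<beta> = j - m. \<Sum>ns\<in>compositions r m.
        \<Sum>\<alpha>s | length \<alpha>s = r \<and> (\<forall>i<r. mi_size (\<alpha>s ! i) = ns ! i + \<nu>).
          sphere_weight (\<beta> + (\<Sum>i<r. \<alpha>s ! i)) * (b \<beta> * (\<Prod>i<r. a (\<alpha>s ! i))))"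

text \<open>
  All monomials in \<open>prod_part\<close> have degree \<open>j + r * \<nu>\<close>, so their integrals have the Gamma value
  and the power of \<open>c\<close> in common and differ only in the sphere weight.
\<close>
lemma has_bochner_integral_exp_norm_prod_part:
  fixes a b :: "('d::finite) multi_index \<Rightarrow> real"
  assumes "0 < c" and "1 \<le> \<nu>"
  shows "has_bochner_integral lborel (\<lambda>x. exp (- c * norm x ^ \<nu>) * prod_part a b \<nu> r j x)
    (1 / real \<nu> * Gamma (real (CARD('d) + (j + r * \<nu>)) / \<nu>) *
     c powr (- real (CARD('d) + (j + r * \<nu>)) / \<nu>) * (\<Sum>m\<le>j. weight_sum a b \<nu> r j m))"
  unfolding prod_part_expand weight_sum_def sum_distrib_left
proof (intro has_bochner_integral_sum)
  fix m \<beta> ns \<alpha>s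
  assume m: "m \<in> {..j}" and \<beta>: "\<beta> \<in> {\<beta> :: 'd multi_index. mi_size \<beta> = j - m}"
    and ns: "ns \<in> compositions r m"
    and \<alpha>s: "\<alpha>s \<in> {\<alpha>s :: 'd multi_index list. length \<alpha>s = r \<and> (\<forall>i<r. mi_size (\<alpha>s ! i) = ns ! i + \<nu>)}"
  have "(\<Sum>i<r. mi_size (\<alpha>s ! i)) = (\<Sum>i<r. ns ! i) + r * \<nu>"
    using \<alpha>s by (simp add: sum.distrib)
  also have "(\<Sum>i<r. ns ! i) = m"
    using ns by (auto simp: compositions_def sum_list_sum_nth atLeast0LessThan)
  finally have "mi_size (\<beta> + (\<Sum>i<r. \<alpha>s ! i)) = j + r * \<nu>"
    using m \<beta> by (simp add: mi_size_add mi_size_sum)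
  from has_bochner_integral_mult_right[OF
      has_bochner_integral_exp_norm_mi_power[OF assms, of "\<beta> + (\<Sum>i<r. \<alpha>s ! i)", unfolded this],
      of "b \<beta> * (\<Prod>i<r. a (\<alpha>s ! i))"]
  show "has_bochner_integral lborel
     (\<lambda>x. exp (- c * norm x ^ \<nu>) * (b \<beta> * (\<Prod>i<r. a (\<alpha>s ! i)) * mi_power x (\<beta> + (\<Sum>i<r. \<alpha>s ! i))))
     (1 / real \<nu> * Gamma (real (CARD('d) + (j + r * \<nu>)) / \<nu>) *
      c powr (- real (CARD('d) + (j + r * \<nu>)) / \<nu>) *
      (sphere_weight (\<beta> + (\<Sum>i<r. \<alpha>s ! i)) * (b \<beta> * (\<Prod>i<r. a (\<alpha>s ! i)))))"
    by (simp add: mult_ac)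
qed

lemma gbinomial_neg_Gamma:
  fixes s :: real
  assumes "0 < s"
  shows "(- 1) ^ r / fact r * Gamma (s + real r) = ((- s) gchoose r) * Gamma s"
proof -
  have "s \<notin> \<int>\<^sub>\<le>\<^sub>0" using assms nonpos_Ints_nonpos[of s] by force
  then have "pochhammer s r = Gamma (s + real r) / Gamma s" by (rule pochhammer_Gamma)
  moreover have "Gamma s \<noteq> 0" using Gamma_real_pos[OF assms] by simp
  ultimately show ?thesis by (simp add: gbinomial_pochhammer field_simps)
qed

text \<open>
  With \<open>c = k * f\<^sub>0\<close> the exponent of \<open>k\<close> in the integral of the part \<open>(r, j)\<close> contains \<open>- r\<close>, which
  cancels the factor \<open>k ^ r\<close> of the exponential series.  Hence the power of \<open>k\<close> depends on
  \<open>j\<close> alone.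
\<close>
lemma laplace_term_value:
  assumes "0 < k" "0 < f\<^sub>0" and "1 \<le> \<nu>" "0 < d"
  shows "(- k) ^ r / fact r * (1 / real \<nu> * Gamma (real (d + (j + r * \<nu>)) / \<nu>) *
     (k * f\<^sub>0) powr (- real (d + (j + r * \<nu>)) / \<nu>) * W) =
     k powr (- real d / \<nu>) * k powr (- real j / \<nu>) *
     (1 / real \<nu> * Gamma ((real d + real j) / \<nu>) * f\<^sub>0 powr (- (real j + real d) / \<nu>) *
      (((- (real d + real j) / \<nu>) gchoose r) * (1 / f\<^sub>0 ^ r) * W))"
proof -
  define s where "s = (real d + real j) / \<nu>"
  have s: "0 < s" using assms by (simp add: s_def add_pos_nonneg)
  have e: "real (d + (j + r * \<nu>)) / \<nu> = s + real r"
    using assms by (simp add: s_def field_simps)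
  have k: "k powr (- real d / \<nu>) * k powr (- real j / \<nu>) = k powr (- s)"
  proof -
    have "- real d / \<nu> + - real j / \<nu> = - s" by (simp add: s_def add_divide_distrib)
    then show ?thesis by (simp only: powr_add[symmetric])
  qed
  have c: "(k * f\<^sub>0) powr (- (s + real r)) = k powr (- s) * f\<^sub>0 powr (- s) / (k ^ r * f\<^sub>0 ^ r)"
    using assms(1,2) by (simp add: powr_mult powr_diff powr_realpow flip: diff_conv_add_uminus)
  have "(- k) ^ r / fact r * (1 / real \<nu> * Gamma (s + real r) * (k * f\<^sub>0) powr (- (s + real r)) * W) =
     k powr (- s) * (1 / real \<nu> * ((- 1) ^ r / fact r * Gamma (s + real r)) * f\<^sub>0 powr (- s) * (1 / f\<^sub>0 ^ r * W))"
    unfolding c power_minus[of k] using assms(1,2) by (simp add: field_simps)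
  also have "\<dots> = k powr (- s) * (1 / real \<nu> * Gamma s * f\<^sub>0 powr (- s) * (((- s) gchoose r) * (1 / f\<^sub>0 ^ r) * W))"
    unfolding gbinomial_neg_Gamma[OF s] by (simp add: mult_ac)
  finally show ?thesis
    unfolding k unfolding minus_divide_left[symmetric] e by (simp add: s_def add.commute)
qed

text \<open>
  The range of \<open>r\<close> in the definition depends on \<open>m\<close>, but outside of it there are no compositions of
  \<open>m\<close> into \<open>r\<close> positive parts.  So \<open>r\<close> may run over \<open>{..N}\<close> throughout, as it does in the
  truncated exponential series.
\<close>
lemma laplace_coeff_eq:
  fixes f g :: "real ^ 'd \<Rightarrow> real"
  assumes "j \<le> N"
  shows "laplace_coeff f g f\<^sub>0 \<nu> j =
    (\<Sum>r\<le>N. 1 / real \<nu> * Gamma ((real CARD('d) + real j) / \<nu>) * f\<^sub>0 powr (- (real j + real CARD('d)) / \<nu>) *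
      (((- (real CARD('d) + real j) / \<nu>) gchoose r) * (1 / f\<^sub>0 ^ r) *
       (\<Sum>m\<le>j. weight_sum (\<lambda>\<alpha>. mixed_deriv \<alpha> f 0 / mi_fact \<alpha>) (\<lambda>\<beta>. mixed_deriv \<beta> g 0 / mi_fact \<beta>) \<nu> r j m)))"
proof -
  let ?a = "\<lambda>\<alpha>. mixed_deriv \<alpha> f 0 / mi_fact \<alpha>" and ?b = "\<lambda>\<beta>. mixed_deriv \<beta> g 0 / mi_fact \<beta>"
  let ?B = "\<lambda>r. ((- (real CARD('d) + real j) / real \<nu>) gchoose r) * (1 / f\<^sub>0 ^ r)"
  have "laplace_coeff f g f\<^sub>0 \<nu> j = 1 / real \<nu> * Gamma ((real CARD('d) + real j) / real \<nu>) *
     f\<^sub>0 powr (- (real j + real CARD('d)) / real \<nu>) *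
     (\<Sum>m\<le>j. \<Sum>r\<in>(if m = 0 then {0} else {1..m}). ?B r * weight_sum ?a ?b \<nu> r j m)"
    unfolding laplace_coeff_def weight_sum_def atLeast0AtMost
    by (simp add: prod_dividef)
  also have "(\<Sum>m\<le>j. \<Sum>r\<in>(if m = 0 then {0} else {1..m}). ?B r * weight_sum ?a ?b \<nu> r j m) =
      (\<Sum>m\<le>j. \<Sum>r\<le>N. ?B r * weight_sum ?a ?b \<nu> r j m)"
  proof (rule sum.cong[OF refl], rule sum.mono_neutral_left)
    fix m assume m: "m \<in> {..j}"
    then show "(if m = 0 then {0} else {1..m}) \<subseteq> {..N}" using assms by auto
    show "\<forall>r\<in>{..N} - (if m = 0 then {0} else {1..m}). ?B r * weight_sum ?a ?b \<nu> r j m = 0"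
    proof
      fix r assume "r \<in> {..N} - (if m = 0 then {0} else {1..m})"
      then have "r = 0 \<and> 0 < m \<or> m < r" by (auto split: if_splits)
      then have "compositions r m = {}" by (auto simp: compositions_0 compositions_eq_empty)
      then show "?B r * weight_sum ?a ?b \<nu> r j m = 0" by (simp add: weight_sum_def)
    qed
  qed auto
  also have "\<dots> = (\<Sum>r\<le>N. \<Sum>m\<le>j. ?B r * weight_sum ?a ?b \<nu> r j m)" by (rule sum.swap)
  finally show ?thesis by (simp add: sum_distrib_left)
qed

section \<open>Pointwise estimates of the integrand\<close>

lemma bigo_bound:
  fixes f g :: "'a \<Rightarrow> real"
  assumes "f \<in> O[F](g)"
  shows "\<exists>c>0. \<forall>\<^sub>F x in F. \<bar>f x\<bar> \<le> c * \<bar>g x\<bar>"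
  using assms by (auto simp: bigo_def)

lemma abs_exp_Taylor_remainder_le:
  fixes u :: real
  shows "\<bar>exp u - (\<Sum>r\<le>N. u ^ r / fact r)\<bar> \<le> \<bar>u\<bar> ^ (N + 1) * exp \<bar>u\<bar>"
proof -
  obtain t where t: "\<bar>t\<bar> \<le> \<bar>u\<bar>" "exp u = (\<Sum>r<N + 1. u ^ r / fact r) + exp t / fact (N + 1) * u ^ (N + 1)"
    using Maclaurin_exp_le by blast
  have "\<bar>exp u - (\<Sum>r\<le>N. u ^ r / fact r)\<bar> = \<bar>u\<bar> ^ (N + 1) * (exp t / fact (N + 1))"
    unfolding t(2) by (simp add: lessThan_Suc_atMost abs_mult power_abs)
  also have "\<dots> \<le> \<bar>u\<bar> ^ (N + 1) * (exp \<bar>u\<bar> / 1)"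
    using t(1) fact_ge_1[of "N + 1", where 'a = real] by (intro mult_left_mono frac_le) (auto simp del: fact_Suc)
  finally show ?thesis by simp
qed

text \<open>
  Here \<open>T r j\<close> stands for the part of degree \<open>r * \<nu> + j\<close> of \<open>E ^ r * g\<close>.
\<close>
definition laplace_main :: "nat \<Rightarrow> nat \<Rightarrow> real \<Rightarrow> (nat \<Rightarrow> nat \<Rightarrow> 'a::real_normed_vector \<Rightarrow> real) \<Rightarrow> real \<Rightarrow> 'a \<Rightarrow> real" where
  "laplace_main N \<nu> c T k x =
     exp (- (k * c) * norm x ^ \<nu>) * (\<Sum>r\<le>N. (- k) ^ r / fact r * (\<Sum>j\<le>N. T r j x))"

text \<open>
  Half of the exponent is given up to absorb \<open>exp (k * \<bar>E x\<bar>)\<close>.  The index \<open>r = N + 1\<close> serves the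
  remainder of the exponential series, the smaller ones the remainders of \<open>E ^ r * g\<close> and
  the main part far from the origin.
\<close>
definition laplace_majorant :: "nat \<Rightarrow> nat \<Rightarrow> real \<Rightarrow> real \<Rightarrow> 'a::real_normed_vector \<Rightarrow> real" where
  "laplace_majorant N \<nu> c k x =
     (\<Sum>r\<le>N + 1. k ^ r * (exp (- (k * (c / 2)) * norm x ^ \<nu>) * norm x ^ (r * \<nu> + N + 1)))"

text \<open>
  The error has two sources.  Breaking off the exponential series after order \<open>N\<close> costs at most
  \<open>(k * \<bar>E x\<bar>) ^ (N + 1) * exp (k * \<bar>E x\<bar>)\<close>, and \<open>(norm x ^ (\<nu> + 1)) ^ (N + 1)\<close> is the power of
  \<open>norm x\<close> for \<open>r = N + 1\<close>.  Replacing \<open>E ^ r * g\<close> by its parts costs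
  \<open>O(norm x ^ (r * \<nu> + N + 1))\<close> for each \<open>r \<le> N\<close>.  It matters that the constant and the
  neighbourhood are the same for all \<open>k\<close>.
\<close>
lemma laplace_local_estimate:
  fixes E g :: "'a::real_normed_vector \<Rightarrow> real"
  assumes "0 < c"
    and T: "\<And>r. r \<le> N \<Longrightarrow> graded_expansion N (r * \<nu>) (\<lambda>x. E x ^ r * g x) (T r)"
    and E: "E \<in> O[at 0](\<lambda>x. norm x ^ (\<nu> + 1))"
  obtains C where "0 \<le> C" "\<forall>\<^sub>F x in at 0. \<forall>k\<ge>0.
    \<bar>exp (- k * (c * norm x ^ \<nu> + E x)) * g x - laplace_main N \<nu> c T k x\<bar> \<le> C * laplace_majorant N \<nu> c k x"
proof -
  have "\<forall>r. \<exists>b>0. r \<le> N \<longrightarrow> (\<forall>\<^sub>F x in at 0.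
      \<bar>E x ^ r * g x - (\<Sum>j\<le>N. T r j x)\<bar> \<le> b * norm x ^ (r * \<nu> + N + 1))"
  proof
    fix r
    show "\<exists>b>0. r \<le> N \<longrightarrow> (\<forall>\<^sub>F x in at 0.
      \<bar>E x ^ r * g x - (\<Sum>j\<le>N. T r j x)\<bar> \<le> b * norm x ^ (r * \<nu> + N + 1))"
    proof (cases "r \<le> N")
      case True
      from bigo_bound[OF conjunct2[OF T[OF this, unfolded graded_expansion_def]]]
      obtain b where "b > 0" "\<forall>\<^sub>F x in at 0.
        \<bar>E x ^ r * g x - (\<Sum>j\<le>N. T r j x)\<bar> \<le> b * \<bar>norm x ^ (r * \<nu> + N + 1)\<bar>"
        by blast
      then show ?thesis by (intro exI[of _ b]) simp
    qed (auto intro: exI[of _ 1])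
  qed
  from choice[OF this] obtain b where "\<forall>r. 0 < b r \<and> (r \<le> N \<longrightarrow> (\<forall>\<^sub>F x in at 0.
      \<bar>E x ^ r * g x - (\<Sum>j\<le>N. T r j x)\<bar> \<le> b r * norm x ^ (r * \<nu> + N + 1)))" ..
  then have b: "\<And>r. 0 < b r" "\<And>r. r \<le> N \<Longrightarrow> \<forall>\<^sub>F x in at 0.
      \<bar>E x ^ r * g x - (\<Sum>j\<le>N. T r j x)\<bar> \<le> b r * norm x ^ (r * \<nu> + N + 1)"
    by simp_all
  from bigo_bound[OF E] obtain e where
    e: "0 < e" "\<forall>\<^sub>F x in at 0. \<bar>E x\<bar> \<le> e * \<bar>norm x ^ (\<nu> + 1)\<bar>"
    by blast
  have "g \<in> O[at 0](\<lambda>x. norm x ^ 0)"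
    using graded_expansion_bigo[OF T[of 0], of 0] by simp
  from bigo_bound[OF this] obtain G where
    G: "0 < G" "\<forall>\<^sub>F x in at 0. \<bar>g x\<bar> \<le> G * \<bar>norm x ^ 0\<bar>"
    by blast
  \<comment> \<open>In this ball \<open>\<bar>E x\<bar> \<le> (c / 2) * norm x ^ \<nu>\<close>.\<close>
  have small: "\<forall>\<^sub>F x :: 'a in at 0. norm x < c / 2 / e"
    using eventually_at_ball[of "c / 2 / e" "0 :: 'a" UNIV] \<open>0 < c\<close> e(1) by (auto elim: eventually_mono)
  have all: "\<forall>\<^sub>F x in at 0. \<forall>r\<in>{..N}.
      \<bar>E x ^ r * g x - (\<Sum>j\<le>N. T r j x)\<bar> \<le> b r * norm x ^ (r * \<nu> + N + 1)"
    using b(2) by (intro eventually_ball_finite) auto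
  define B where "B = Max (insert (e ^ (N + 1) * G) (b ` {..N}))"
  have B: "e ^ (N + 1) * G \<le> B" "\<And>r. r \<le> N \<Longrightarrow> b r \<le> B"
    unfolding B_def by (rule Max_ge; simp)+
  have "0 \<le> B" using B(2)[of 0] b(1)[of 0] by linarith
  moreover have "\<forall>\<^sub>F x in at 0. \<forall>k\<ge>0.
    \<bar>exp (- k * (c * norm x ^ \<nu> + E x)) * g x - laplace_main N \<nu> c T k x\<bar> \<le> B * laplace_majorant N \<nu> c k x"
    using all e(2) G(2) small
  proof eventually_elim
    case (elim x)
    show ?case
    proof (intro allI impI)
      fix k :: real assume k: "0 \<le> k"
      let ?n = "norm x" and ?u = "exp (- (k * c) * norm x ^ \<nu>)" and ?h = "exp (- (k * (c / 2)) * norm x ^ \<nu>)"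
      let ?R = "exp (- k * E x) - (\<Sum>r\<le>N. (- k * E x) ^ r / fact r)"
      have Eb: "\<bar>E x\<bar> \<le> e * ?n ^ (\<nu> + 1)" and gb: "\<bar>g x\<bar> \<le> G" using elim by auto
      have "e * ?n ^ (\<nu> + 1) = (e * ?n) * ?n ^ \<nu>" by simp
      also have "\<dots> \<le> (c / 2) * ?n ^ \<nu>"
        using elim(4) e(1) by (intro mult_right_mono) (auto simp: field_simps)
      finally have Ec: "\<bar>E x\<bar> \<le> (c / 2) * ?n ^ \<nu>" using Eb by linarith
      have ee: "?u * exp (k * \<bar>E x\<bar>) \<le> ?h"
      proof -
        have "- (k * c) * ?n ^ \<nu> + k * \<bar>E x\<bar> \<le> - (k * (c / 2)) * ?n ^ \<nu>"
          using mult_left_mono[OF Ec k] by (simp add: field_simps)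
        then show ?thesis by (simp only: exp_add[symmetric] exp_le_cancel_iff)
      qed
      have e0: "?u \<le> ?h" using k \<open>0 < c\<close> by (simp add: mult_left_mono)
      have "exp (- k * (c * ?n ^ \<nu> + E x)) = ?u * exp (- k * E x)"
        by (simp add: algebra_simps flip: exp_add)
      moreover have "(\<Sum>r\<le>N. (- k) ^ r / fact r * (E x ^ r * g x - (\<Sum>j\<le>N. T r j x))) =
          (\<Sum>r\<le>N. (- k * E x) ^ r / fact r) * g x - (\<Sum>r\<le>N. (- k) ^ r / fact r * (\<Sum>j\<le>N. T r j x))"
        unfolding power_mult_distrib sum_distrib_right sum_subtractf[symmetric]
        by (intro sum.cong refl) (simp add: right_diff_distrib)
      ultimately have split: "exp (- k * (c * ?n ^ \<nu> + E x)) * g x - laplace_main N \<nu> c T k x =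
        ?u * (?R * g x) + ?u * (\<Sum>r\<le>N. (- k) ^ r / fact r * (E x ^ r * g x - (\<Sum>j\<le>N. T r j x)))"
        unfolding laplace_main_def by (simp only: ring_distribs mult.assoc)
      have "\<bar>exp (- k * (c * ?n ^ \<nu> + E x)) * g x - laplace_main N \<nu> c T k x\<bar> \<le> ?u * (\<bar>?R\<bar> * \<bar>g x\<bar>) +
          ?u * (\<Sum>r\<le>N. k ^ r / fact r * \<bar>E x ^ r * g x - (\<Sum>j\<le>N. T r j x)\<bar>)"
        unfolding split
      proof (rule order_trans[OF abs_triangle_ineq add_mono])
        show "\<bar>?u * (?R * g x)\<bar> \<le> ?u * (\<bar>?R\<bar> * \<bar>g x\<bar>)" by (simp add: abs_mult)
        have "\<bar>\<Sum>r\<le>N. (- k) ^ r / fact r * (E x ^ r * g x - (\<Sum>j\<le>N. T r j x))\<bar> \<le>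
            (\<Sum>r\<le>N. \<bar>(- k) ^ r / fact r * (E x ^ r * g x - (\<Sum>j\<le>N. T r j x))\<bar>)"
          by (rule sum_abs)
        also have "\<dots> = (\<Sum>r\<le>N. k ^ r / fact r * \<bar>E x ^ r * g x - (\<Sum>j\<le>N. T r j x)\<bar>)"
          using k by (simp add: abs_mult power_abs)
        finally show "\<bar>?u * (\<Sum>r\<le>N. (- k) ^ r / fact r * (E x ^ r * g x - (\<Sum>j\<le>N. T r j x)))\<bar> \<le>
           ?u * (\<Sum>r\<le>N. k ^ r / fact r * \<bar>E x ^ r * g x - (\<Sum>j\<le>N. T r j x)\<bar>)"
          by (simp add: abs_mult)
      qed
      also have "\<dots> \<le> ?h * (k ^ (N + 1) * (B * ?n ^ ((N + 1) * \<nu> + N + 1))) +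
          ?h * (\<Sum>r\<le>N. k ^ r * (B * ?n ^ (r * \<nu> + N + 1)))"
      proof (rule add_mono)
        have "\<bar>?R\<bar> \<le> (k * \<bar>E x\<bar>) ^ (N + 1) * exp (k * \<bar>E x\<bar>)"
          using abs_exp_Taylor_remainder_le[of "- k * E x" N] k by (simp add: abs_mult)
        then have "?u * (\<bar>?R\<bar> * \<bar>g x\<bar>) \<le> ?u * (((k * \<bar>E x\<bar>) ^ (N + 1) * exp (k * \<bar>E x\<bar>)) * G)"
          using gb k by (intro mult_left_mono mult_mono) auto
        also have "\<dots> = (?u * exp (k * \<bar>E x\<bar>)) * (k ^ (N + 1) * (\<bar>E x\<bar> ^ (N + 1) * G))"
          by (simp add: power_mult_distrib mult_ac)
        also have "\<dots> \<le> ?h * (k ^ (N + 1) * ((e * ?n ^ (\<nu> + 1)) ^ (N + 1) * G))"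
          using ee Eb k G(1) e(1) by (intro mult_mono mult_left_mono mult_right_mono power_mono) auto
        also have "(e * ?n ^ (\<nu> + 1)) ^ (N + 1) * G = (e ^ (N + 1) * G) * ?n ^ ((N + 1) * \<nu> + N + 1)"
        proof -
          have "(\<nu> + 1) * (N + 1) = (N + 1) * \<nu> + N + 1" by (simp add: algebra_simps)
          then have "(?n ^ (\<nu> + 1)) ^ (N + 1) = ?n ^ ((N + 1) * \<nu> + N + 1)"
            by (simp only: power_mult[symmetric])
          then show ?thesis by (simp only: power_mult_distrib mult_ac)
        qed
        also have "?h * (k ^ (N + 1) * \<dots>) \<le> ?h * (k ^ (N + 1) * (B * ?n ^ ((N + 1) * \<nu> + N + 1)))"
          using B(1) k by (intro mult_left_mono mult_right_mono) auto
        finally show "?u * (\<bar>?R\<bar> * \<bar>g x\<bar>) \<le> ?h * (k ^ (N + 1) * (B * ?n ^ ((N + 1) * \<nu> + N + 1)))" .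
        have "(\<Sum>r\<le>N. k ^ r / fact r * \<bar>E x ^ r * g x - (\<Sum>j\<le>N. T r j x)\<bar>) \<le>
            (\<Sum>r\<le>N. k ^ r * (B * ?n ^ (r * \<nu> + N + 1)))"
        proof (intro sum_mono mult_mono)
          fix r assume r: "r \<in> {..N}"
          show "k ^ r / fact r \<le> k ^ r"
            using k fact_ge_1[of r, where 'a = real] by (simp add: divide_le_eq mult_le_cancel_left1)
          have "\<bar>E x ^ r * g x - (\<Sum>j\<le>N. T r j x)\<bar> \<le> b r * ?n ^ (r * \<nu> + N + 1)" using elim(1) r by blast
          also have "\<dots> \<le> B * ?n ^ (r * \<nu> + N + 1)" using B(2) r by (intro mult_right_mono) auto
          finally show "\<bar>E x ^ r * g x - (\<Sum>j\<le>N. T r j x)\<bar> \<le> B * ?n ^ (r * \<nu> + N + 1)" .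
        qed (use k in auto)
        then show "?u * (\<Sum>r\<le>N. k ^ r / fact r * \<bar>E x ^ r * g x - (\<Sum>j\<le>N. T r j x)\<bar>) \<le>
            ?h * (\<Sum>r\<le>N. k ^ r * (B * ?n ^ (r * \<nu> + N + 1)))"
          using e0 k by (intro mult_mono) (auto intro!: sum_nonneg)
      qed
      also have "\<dots> = B * laplace_majorant N \<nu> c k x"
        by (simp add: laplace_majorant_def sum_distrib_left distrib_left mult_ac)
      finally show "\<bar>exp (- k * (c * ?n ^ \<nu> + E x)) * g x - laplace_main N \<nu> c T k x\<bar> \<le>
          B * laplace_majorant N \<nu> c k x" .
    qed
  qed
  ultimately show ?thesis by (rule that)
qed

text \<open>
  A part of degree \<open>r * \<nu> + j\<close> lacks \<open>N + 1 - j\<close> powers of \<open>norm x\<close> compared with the majorant;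
  they are supplied by a power of \<open>norm x / \<delta> \<ge> 1\<close>.  This makes it possible to integrate the main
  part over the whole space.
\<close>
lemma laplace_main_tail_estimate:
  fixes T :: "nat \<Rightarrow> nat \<Rightarrow> 'a::real_normed_vector \<Rightarrow> real"
  assumes "0 < c" "0 < \<delta>"
    and T: "\<And>r j. r \<le> N \<Longrightarrow> j \<le> N \<Longrightarrow> T r j \<in> O[top](\<lambda>x. norm x ^ (r * \<nu> + j))"
  obtains C where "0 \<le> C"
    "\<And>k x. 0 \<le> k \<Longrightarrow> \<delta> \<le> norm x \<Longrightarrow> \<bar>laplace_main N \<nu> c T k x\<bar> \<le> C * laplace_majorant N \<nu> c k x"
proof -
  have "\<forall>r j. \<exists>b>0. r \<le> N \<longrightarrow> j \<le> N \<longrightarrow> (\<forall>x. \<bar>T r j x\<bar> \<le> b * norm x ^ (r * \<nu> + j))"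
  proof (intro allI)
    fix r j
    show "\<exists>b>0. r \<le> N \<longrightarrow> j \<le> N \<longrightarrow> (\<forall>x. \<bar>T r j x\<bar> \<le> b * norm x ^ (r * \<nu> + j))"
    proof (cases "r \<le> N \<and> j \<le> N")
      case True
      from bigo_bound[OF T[OF conjunct1[OF this] conjunct2[OF this]]] obtain b
        where "0 < b \<and> (\<forall>\<^sub>F x in top. \<bar>T r j x\<bar> \<le> b * \<bar>norm x ^ (r * \<nu> + j)\<bar>)" ..
      then show ?thesis by (intro exI[of _ b]) (simp add: eventually_top)
    qed (auto intro: exI[of _ 1])
  qed
  then have "\<forall>r. \<exists>b. \<forall>j. 0 < b j \<and> (r \<le> N \<longrightarrow> j \<le> N \<longrightarrow> (\<forall>x. \<bar>T r j x\<bar> \<le> b j * norm x ^ (r * \<nu> + j)))"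
    by (intro allI choice) blast
  from choice[OF this] obtain b where
    "\<forall>r j. 0 < b r j \<and> (r \<le> N \<longrightarrow> j \<le> N \<longrightarrow> (\<forall>x. \<bar>T r j x\<bar> \<le> b r j * norm x ^ (r * \<nu> + j)))" ..
  then have b: "\<And>r j. 0 < b r j"
      "\<And>r j x. r \<le> N \<Longrightarrow> j \<le> N \<Longrightarrow> \<bar>T r j x\<bar> \<le> b r j * norm x ^ (r * \<nu> + j)"
    by simp_all
  define C where "C = (\<Sum>r\<le>N. \<Sum>j\<le>N. b r j / \<delta> ^ (N + 1 - j))"
  have "0 \<le> C" unfolding C_def using b(1) \<open>0 < \<delta>\<close> by (intro sum_nonneg) (auto intro: less_imp_le)
  moreover have "\<bar>laplace_main N \<nu> c T k x\<bar> \<le> C * laplace_majorant N \<nu> c k x"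
    if k: "0 \<le> k" and x: "\<delta> \<le> norm x" for k x
  proof -
    let ?n = "norm x" and ?u = "exp (- (k * c) * norm x ^ \<nu>)" and ?h = "exp (- (k * (c / 2)) * norm x ^ \<nu>)"
    have e0: "?u \<le> ?h" using k \<open>0 < c\<close> by (simp add: mult_left_mono)
    have Tb: "\<bar>\<Sum>j\<le>N. T r j x\<bar> \<le> C * ?n ^ (r * \<nu> + N + 1)" if r: "r \<le> N" for r
    proof -
      have "\<bar>\<Sum>j\<le>N. T r j x\<bar> \<le> (\<Sum>j\<le>N. \<bar>T r j x\<bar>)" by (rule sum_abs)
      also have "\<dots> \<le> (\<Sum>j\<le>N. b r j / \<delta> ^ (N + 1 - j) * ?n ^ (r * \<nu> + N + 1))"
      proof (rule sum_mono)
        fix j assume j: "j \<in> {..N}"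
        have "\<bar>T r j x\<bar> \<le> b r j * ?n ^ (r * \<nu> + j)" using b(2) r j by simp
        also have "\<dots> \<le> b r j * (?n ^ (r * \<nu> + j) * (?n / \<delta>) ^ (N + 1 - j))"
        proof -
          have "1 \<le> (?n / \<delta>) ^ (N + 1 - j)" using x \<open>0 < \<delta>\<close> by (intro one_le_power) simp
          then have "?n ^ (r * \<nu> + j) * 1 \<le> ?n ^ (r * \<nu> + j) * (?n / \<delta>) ^ (N + 1 - j)"
            by (intro mult_left_mono) auto
          then show ?thesis using b(1)[of r j] by (intro mult_left_mono) auto
        qed
        also have "\<dots> = b r j / \<delta> ^ (N + 1 - j) * ?n ^ (r * \<nu> + N + 1)"
        proof -
          have "?n ^ (r * \<nu> + j) * ?n ^ (N + 1 - j) = ?n ^ (r * \<nu> + N + 1)"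
            using j by (simp flip: power_add)
          then show ?thesis by (simp add: power_divide)
        qed
        finally show "\<bar>T r j x\<bar> \<le> b r j / \<delta> ^ (N + 1 - j) * ?n ^ (r * \<nu> + N + 1)" .
      qed
      also have "\<dots> = (\<Sum>j\<le>N. b r j / \<delta> ^ (N + 1 - j)) * ?n ^ (r * \<nu> + N + 1)"
        by (simp add: sum_distrib_right)
      also have "\<dots> \<le> C * ?n ^ (r * \<nu> + N + 1)"
        unfolding C_def using r b(1) \<open>0 < \<delta>\<close>
        by (intro mult_right_mono member_le_sum[where f = "\<lambda>r. \<Sum>j\<le>N. b r j / \<delta> ^ (N + 1 - j)"])
           (auto intro!: sum_nonneg intro: less_imp_le)
      finally show ?thesis .
    qed
    have "\<bar>laplace_main N \<nu> c T k x\<bar> = ?u * \<bar>\<Sum>r\<le>N. (- k) ^ r / fact r * (\<Sum>j\<le>N. T r j x)\<bar>"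
      by (simp add: laplace_main_def abs_mult)
    also have "\<dots> \<le> ?h * (\<Sum>r\<le>N + 1. k ^ r * (C * ?n ^ (r * \<nu> + N + 1)))"
    proof (rule mult_mono)
      have "\<bar>\<Sum>r\<le>N. (- k) ^ r / fact r * (\<Sum>j\<le>N. T r j x)\<bar> \<le> (\<Sum>r\<le>N. \<bar>(- k) ^ r / fact r * (\<Sum>j\<le>N. T r j x)\<bar>)"
        by (rule sum_abs)
      also have "\<dots> \<le> (\<Sum>r\<le>N. k ^ r * (C * ?n ^ (r * \<nu> + N + 1)))"
      proof (rule sum_mono)
        fix r assume r: "r \<in> {..N}"
        have "\<bar>(- k) ^ r / fact r\<bar> \<le> k ^ r"
          using k fact_ge_1[of r, where 'a = real]
          by (simp add: power_abs divide_le_eq mult_le_cancel_left1)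
        then show "\<bar>(- k) ^ r / fact r * (\<Sum>j\<le>N. T r j x)\<bar> \<le> k ^ r * (C * ?n ^ (r * \<nu> + N + 1))"
          unfolding abs_mult using Tb r k by (intro mult_mono) auto
      qed
      also have "\<dots> \<le> (\<Sum>r\<le>N + 1. k ^ r * (C * ?n ^ (r * \<nu> + N + 1)))"
        using k \<open>0 \<le> C\<close> by (intro sum_mono2) auto
      finally show "\<bar>\<Sum>r\<le>N. (- k) ^ r / fact r * (\<Sum>j\<le>N. T r j x)\<bar> \<le> \<dots>" .
    qed (use e0 in auto)
    also have "\<dots> = C * laplace_majorant N \<nu> c k x"
      by (simp only: laplace_majorant_def sum_distrib_left mult_ac)
    finally show ?thesis .
  qed
  ultimately show ?thesis by (rule that)
qed

section \<open>Expansion and integrals for the given Taylor data\<close>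

text \<open>
  \<open>E = f - hom_part a \<nu>\<close> has the parts \<open>hom_part a (\<nu> + n)\<close> for \<open>n \<ge> 1\<close>.  Setting the part with
  \<open>n = 0\<close> to zero turns the powers of \<open>E\<close> into sums over compositions.
\<close>
lemma graded_expansion_prod_part:
  fixes a b :: "('d::finite) multi_index \<Rightarrow> real"
  assumes f: "(\<lambda>x. f x - (\<Sum>n\<le>N. hom_part a (n + \<nu>) x)) \<in> O[at 0](\<lambda>x. norm x ^ (N + \<nu> + 1))"
    and g: "(\<lambda>x. g x - (\<Sum>n\<le>N. hom_part b n x)) \<in> O[at 0](\<lambda>x. norm x ^ (N + 1))"
  shows "graded_expansion N (r * \<nu>) (\<lambda>x. (f x - hom_part a \<nu> x) ^ r * g x) (prod_part a b \<nu> r)"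
    and "(\<lambda>x. f x - hom_part a \<nu> x) \<in> O[at 0](\<lambda>x. norm x ^ (\<nu> + 1))"
proof -
  define A where "A n x = (if n = 0 then 0 else hom_part a (n + \<nu>) x)" for n x
  have A0: "A 0 x = 0" for x by (simp add: A_def)
  have sumA: "(\<Sum>n\<le>N. A n x) = (\<Sum>n\<le>N. hom_part a (n + \<nu>) x) - hom_part a \<nu> x" for x
    by (induction N) (auto simp: A_def)
  have "A n \<in> O[top](\<lambda>x. norm x ^ (\<nu> + n))" for n
    using hom_part_bigo[of a "n + \<nu>"] by (cases "n = 0") (auto simp: A_def[abs_def] add.commute)
  moreover have "(\<lambda>x. f x - hom_part a \<nu> x - (\<Sum>n\<le>N. A n x)) \<in> O[at 0](\<lambda>x. norm x ^ (\<nu> + N + 1))"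
    using f by (simp add: sumA add_ac)
  ultimately have E: "graded_expansion N \<nu> (\<lambda>x. f x - hom_part a \<nu> x) A"
    by (simp add: graded_expansion_def)
  show "(\<lambda>x. f x - hom_part a \<nu> x) \<in> O[at 0](\<lambda>x. norm x ^ (\<nu> + 1))"
    by (rule graded_expansion_bigo[OF E]) (auto simp: A0)
  have G: "graded_expansion N 0 g (hom_part b)"
    using g hom_part_bigo[of b] by (simp add: graded_expansion_def)
  have "prod_part a b \<nu> r = (\<lambda>n x. \<Sum>i\<le>n. (\<Sum>ns\<in>compositions r i. \<Prod>l<r. A (ns ! l) x) * hom_part b (n - i) x)"
  proof (intro ext)
    fix j x
    have "(\<Prod>i<r. hom_part a (ns ! i + \<nu>) x) = (\<Prod>i<r. A (ns ! i) x)" if "ns \<in> compositions r m" for ns m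
    proof (intro prod.cong refl)
      fix i assume "i \<in> {..<r}"
      then have "1 \<le> ns ! i" using that by (simp add: compositions_def)
      then show "hom_part a (ns ! i + \<nu>) x = A (ns ! i) x" by (simp add: A_def)
    qed
    then show "prod_part a b \<nu> r j x = (\<Sum>m\<le>j. (\<Sum>ns\<in>compositions r m. \<Prod>i<r. A (ns ! i) x) * hom_part b (j - m) x)"
      by (simp add: prod_part_def)
  qed
  then show "graded_expansion N (r * \<nu>) (\<lambda>x. (f x - hom_part a \<nu> x) ^ r * g x) (prod_part a b \<nu> r)"
    using graded_expansion_mult[OF graded_expansion_power[OF E A0] G] by simp
qed

lemma hom_part_eq_norm_power:
  fixes a :: "('d::finite) multi_index \<Rightarrow> real"
  assumes "1 \<le> \<nu>" and "\<forall>\<Omega>\<in>sphere 0 1. hom_part a \<nu> \<Omega> = c"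
  shows "hom_part a \<nu> x = c * norm x ^ \<nu>"
proof (cases "x = 0")
  case True
  have "mi_power (0 :: real ^ 'd) \<alpha> = 0" if "mi_size \<alpha> = \<nu>" for \<alpha>
    using abs_mi_power_le[of 0 \<alpha>] that assms(1) by (simp add: zero_power)
  then show ?thesis using True assms(1) by (simp add: hom_part_def zero_power)
next
  case False
  let ?\<Omega> = "x /\<^sub>R norm x"
  have "hom_part a \<nu> x = hom_part a \<nu> (norm x *\<^sub>R ?\<Omega>)" using False by simp
  also have "\<dots> = norm x ^ \<nu> * hom_part a \<nu> ?\<Omega>"
    unfolding hom_part_def sum_distrib_left by (rule sum.cong[OF refl]) (simp only: mem_Collect_eq mi_power_scale mult.left_commute)
  also have "hom_part a \<nu> ?\<Omega> = c" using assms(2) False by simp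
  finally show ?thesis by (simp add: mult.commute)
qed

text \<open>
  The coefficients arise by exchanging the sums over \<open>r\<close> and \<open>j\<close>: for fixed \<open>j\<close> the power of \<open>k\<close>
  is the same for all \<open>r\<close>.
\<close>
lemma has_bochner_integral_laplace_main:
  fixes f g :: "real ^ 'd \<Rightarrow> real"
  assumes "0 < k" "0 < f\<^sub>0" "1 \<le> \<nu>"
  shows "has_bochner_integral lborel
    (laplace_main N \<nu> f\<^sub>0 (prod_part (\<lambda>\<alpha>. mixed_deriv \<alpha> f 0 / mi_fact \<alpha>) (\<lambda>\<beta>. mixed_deriv \<beta> g 0 / mi_fact \<beta>) \<nu>) k)
    (k powr (- real CARD('d) / real \<nu>) * (\<Sum>j=0..N. laplace_coeff f g f\<^sub>0 \<nu> j * k powr (- real j / real \<nu>)))"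
proof -
  let ?a = "\<lambda>\<alpha>. mixed_deriv \<alpha> f 0 / mi_fact \<alpha>" and ?b = "\<lambda>\<beta>. mixed_deriv \<beta> g 0 / mi_fact \<beta>"
  let ?d = "CARD('d)"
  let ?V = "\<lambda>r j. 1 / real \<nu> * Gamma (real (?d + (j + r * \<nu>)) / \<nu>) *
     (k * f\<^sub>0) powr (- real (?d + (j + r * \<nu>)) / \<nu>) * (\<Sum>m\<le>j. weight_sum ?a ?b \<nu> r j m)"
  have "has_bochner_integral lborel (\<lambda>x. \<Sum>r\<le>N. \<Sum>j\<le>N. (- k) ^ r / fact r *
      (exp (- (k * f\<^sub>0) * norm x ^ \<nu>) * prod_part ?a ?b \<nu> r j x)) (\<Sum>r\<le>N. \<Sum>j\<le>N. (- k) ^ r / fact r * ?V r j)"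
    using assms by (intro has_bochner_integral_sum has_bochner_integral_mult_right
        has_bochner_integral_exp_norm_prod_part) auto
  moreover have "(\<lambda>x. \<Sum>r\<le>N. \<Sum>j\<le>N. (- k) ^ r / fact r *
      (exp (- (k * f\<^sub>0) * norm x ^ \<nu>) * prod_part ?a ?b \<nu> r j x)) = laplace_main N \<nu> f\<^sub>0 (prod_part ?a ?b \<nu>) k"
    by (simp add: laplace_main_def fun_eq_iff sum_distrib_left mult_ac)
  moreover have "(\<Sum>r\<le>N. \<Sum>j\<le>N. (- k) ^ r / fact r * ?V r j) =
     k powr (- real ?d / real \<nu>) * (\<Sum>j=0..N. laplace_coeff f g f\<^sub>0 \<nu> j * k powr (- real j / real \<nu>))"
  proof -
    have "(\<Sum>r\<le>N. \<Sum>j\<le>N. (- k) ^ r / fact r * ?V r j) = (\<Sum>j\<le>N. \<Sum>r\<le>N. (- k) ^ r / fact r * ?V r j)"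
      by (rule sum.swap)
    also have "\<dots> = (\<Sum>j\<le>N. k powr (- real ?d / \<nu>) * (laplace_coeff f g f\<^sub>0 \<nu> j * k powr (- real j / \<nu>)))"
    proof (intro sum.cong refl)
      fix j assume "j \<in> {..N}"
      then have j: "j \<le> N" by simp
      show "(\<Sum>r\<le>N. (- k) ^ r / fact r * ?V r j) =
        k powr (- real ?d / \<nu>) * (laplace_coeff f g f\<^sub>0 \<nu> j * k powr (- real j / \<nu>))"
        unfolding laplace_coeff_eq[OF j] laplace_term_value[OF assms zero_less_card_finite]
        by (simp add: sum_distrib_left sum_distrib_right mult_ac)
    qed
    finally show ?thesis by (simp add: sum_distrib_left atLeast0AtMost)
  qed
  ultimately show ?thesis by simp
qed

text \<open>
  The scaling that governs the whole expansion: \<open>k ^ r\<close> and \<open>norm x ^ (r * \<nu>)\<close> balance, so all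
  terms of the majorant have the same order in \<open>k\<close>.
\<close>
lemma has_bochner_integral_laplace_majorant:
  assumes "0 < c" "1 \<le> \<nu>"
  obtains M where "\<And>k. 0 < k \<Longrightarrow> has_bochner_integral lborel (laplace_majorant N \<nu> c k :: 'a::euclidean_space \<Rightarrow> real)
    (M * k powr (- (real N + real DIM('a) + 1) / real \<nu>))"
proof -
  let ?e = "\<lambda>r. real (DIM('a) + (r * \<nu> + N + 1)) / \<nu>"
  have "\<exists>K. \<forall>c>0. has_bochner_integral lborel
    (\<lambda>x :: 'a. exp (- c * norm x ^ \<nu>) * norm x ^ (r * \<nu> + N + 1)) (K * c powr (- ?e r))" for r
    unfolding minus_divide_left by (rule integral_exp_norm_power[OF assms(2), of "r * \<nu> + N + 1", where 'a = 'a]) blast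
  then have "\<forall>r. \<exists>K. \<forall>c>0. has_bochner_integral lborel
    (\<lambda>x :: 'a. exp (- c * norm x ^ \<nu>) * norm x ^ (r * \<nu> + N + 1)) (K * c powr (- ?e r))" ..
  from choice[OF this] obtain K where K: "\<forall>r. \<forall>c>0. has_bochner_integral lborel
    (\<lambda>x :: 'a. exp (- c * norm x ^ \<nu>) * norm x ^ (r * \<nu> + N + 1)) (K r * c powr (- ?e r))" ..
  show ?thesis
  proof (rule that)
    fix k :: real assume k: "0 < k"
    have "has_bochner_integral lborel (laplace_majorant N \<nu> c k :: 'a \<Rightarrow> real)
      (\<Sum>r\<le>N + 1. k ^ r * (K r * (k * (c / 2)) powr (- ?e r)))"
      unfolding laplace_majorant_def[abs_def]
      by (intro has_bochner_integral_sum has_bochner_integral_mult_right K[rule_format])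
         (use k assms(1) in simp)
    also have "(\<Sum>r\<le>N + 1. k ^ r * (K r * (k * (c / 2)) powr (- ?e r))) =
      (\<Sum>r\<le>N + 1. K r * (c / 2) powr (- ?e r)) * k powr (- (real N + real DIM('a) + 1) / real \<nu>)"
      unfolding sum_distrib_right
    proof (intro sum.cong refl)
      fix r
      have "real r + (- ?e r) = - (real N + real DIM('a) + 1) / real \<nu>"
        using assms(2) by (simp add: field_simps)
      then have "k powr (- (real N + real DIM('a) + 1) / real \<nu>) = k powr real r * k powr (- ?e r)"
        by (simp only: powr_add[symmetric])
      also have "k powr real r = k ^ r" using k by (simp add: powr_realpow)
      finally have "k powr (- (real N + real DIM('a) + 1) / real \<nu>) = k ^ r * k powr (- ?e r)" .
      moreover have "(k * (c / 2)) powr (- ?e r) = k powr (- ?e r) * (c / 2) powr (- ?e r)"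
        by (rule powr_mult)
      ultimately show "k ^ r * (K r * (k * (c / 2)) powr (- ?e r)) =
        K r * (c / 2) powr (- ?e r) * k powr (- (real N + real DIM('a) + 1) / real \<nu>)"
        by (simp only: mult_ac)
    qed
    finally show "has_bochner_integral lborel (laplace_majorant N \<nu> c k :: 'a \<Rightarrow> real)
      ((\<Sum>r\<le>N + 1. K r * (c / 2) powr (- ?e r)) * k powr (- (real N + real DIM('a) + 1) / real \<nu>))" .
  qed
qed

section \<open>The asymptotic expansion\<close>

text \<open>
  On a small ball the local estimate applies.  Outside of it the difference is not small by
  cancellation; instead both terms are small: the integrand because \<open>f \<ge> \<epsilon>\<close> there,
  compared with the integrand for \<open>k\<^sub>0\<close>, and the main part by \<open>laplace_main_tail_estimate\<close>.
  The origin is excluded since the expansions of \<open>f\<close> and \<open>g\<close> say nothing about it.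
\<close>
lemma laplace_pointwise_bound:
  fixes f g :: "'a::euclidean_space \<Rightarrow> real"
  assumes "0 < c" and R: "0 \<in> interior R" and nonneg: "\<And>x. x \<in> R \<Longrightarrow> 0 \<le> f x"
    and away: "\<forall>\<delta>>0. 0 < (INF x\<in>{x \<in> R. \<delta> \<le> norm x}. ereal (f x))"
    and T: "\<And>r. r \<le> N \<Longrightarrow> graded_expansion N (r * \<nu>) (\<lambda>x. (f x - c * norm x ^ \<nu>) ^ r * g x) (T r)"
    and E: "(\<lambda>x. f x - c * norm x ^ \<nu>) \<in> O[at 0](\<lambda>x. norm x ^ (\<nu> + 1))"
  obtains \<epsilon> C where "0 < \<epsilon>" "\<And>k x. 0 \<le> k \<Longrightarrow> k\<^sub>0 \<le> k \<Longrightarrow> x \<noteq> 0 \<Longrightarrow>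
    \<bar>indicator R x * (exp (- k * f x) * g x) - laplace_main N \<nu> c T k x\<bar> \<le>
    exp (- (k - k\<^sub>0) * \<epsilon>) * \<bar>indicator R x * (exp (- k\<^sub>0 * f x) * g x)\<bar> + C * laplace_majorant N \<nu> c k x"
proof -
  obtain C where C: "0 \<le> C" "\<forall>\<^sub>F x in at 0. \<forall>k\<ge>0.
    \<bar>exp (- k * (c * norm x ^ \<nu> + (f x - c * norm x ^ \<nu>))) * g x - laplace_main N \<nu> c T k x\<bar> \<le>
      C * laplace_majorant N \<nu> c k x"
    using laplace_local_estimate[OF \<open>0 < c\<close> T E] by blast
  then obtain \<delta>1 where "0 < \<delta>1" and local: "\<And>x k. x \<noteq> 0 \<Longrightarrow> norm x < \<delta>1 \<Longrightarrow> 0 \<le> k \<Longrightarrow>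
    \<bar>exp (- k * f x) * g x - laplace_main N \<nu> c T k x\<bar> \<le> C * laplace_majorant N \<nu> c k x"
    unfolding eventually_at by (auto simp: dist_norm)
  obtain \<delta>2 where "0 < \<delta>2" and ball: "ball 0 \<delta>2 \<subseteq> R"
    using R by (auto simp: mem_interior)
  define \<delta> where "\<delta> = min \<delta>1 \<delta>2"
  have "0 < \<delta>" using \<open>0 < \<delta>1\<close> \<open>0 < \<delta>2\<close> by (simp add: \<delta>_def)
  have "T r j \<in> O[top](\<lambda>x. norm x ^ (r * \<nu> + j))" if "r \<le> N" "j \<le> N" for r j
    using T[OF that(1)] that(2) by (simp add: graded_expansion_def)
  then obtain C' where C': "0 \<le> C'" "\<And>k x. 0 \<le> k \<Longrightarrow> \<delta> \<le> norm x \<Longrightarrow>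
      \<bar>laplace_main N \<nu> c T k x\<bar> \<le> C' * laplace_majorant N \<nu> c k x"
    using laplace_main_tail_estimate[OF \<open>0 < c\<close> \<open>0 < \<delta>\<close>] by blast
  obtain \<epsilon> where "0 < ereal \<epsilon>" and less: "ereal \<epsilon> < (INF x\<in>{x \<in> R. \<delta> \<le> norm x}. ereal (f x))"
    using away \<open>0 < \<delta>\<close> ereal_dense2 by blast
  then have "0 < \<epsilon>" by simp
  have \<epsilon>: "\<epsilon> \<le> f x" if "x \<in> R" "\<delta> \<le> norm x" for x
  proof -
    have "(INF x\<in>{x \<in> R. \<delta> \<le> norm x}. ereal (f x)) \<le> ereal (f x)" using that by (intro INF_lower) simp
    with less have "ereal \<epsilon> < ereal (f x)" by (rule less_le_trans)
    then show ?thesis by simp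
  qed
  show ?thesis
  proof (rule that[of \<epsilon> "max C C'"])
    fix k :: real and x :: 'a
    assume k: "0 \<le> k" "k\<^sub>0 \<le> k" and x: "x \<noteq> 0"
    have maj: "0 \<le> laplace_majorant N \<nu> c k x"
      unfolding laplace_majorant_def using k(1) by (intro sum_nonneg) auto
    let ?J = "exp (- (k - k\<^sub>0) * \<epsilon>) * \<bar>indicator R x * (exp (- k\<^sub>0 * f x) * g x)\<bar>"
    show "\<bar>indicator R x * (exp (- k * f x) * g x) - laplace_main N \<nu> c T k x\<bar> \<le>
      ?J + max C C' * laplace_majorant N \<nu> c k x"
    proof (cases "norm x < \<delta>")
      case True
      then have "x \<in> R" using ball by (auto simp: \<delta>_def)
      then have "\<bar>indicator R x * (exp (- k * f x) * g x) - laplace_main N \<nu> c T k x\<bar> \<le> C * laplace_majorant N \<nu> c k x"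
        using local[OF x _ k(1)] True by (simp add: \<delta>_def)
      also have "\<dots> \<le> max C C' * laplace_majorant N \<nu> c k x" using maj by (intro mult_right_mono) auto
      also have "\<dots> \<le> ?J + \<dots>" by simp
      finally show ?thesis .
    next
      case False
      have 1: "\<bar>indicator R x * (exp (- k * f x) * g x)\<bar> \<le> ?J"
      proof (cases "x \<in> R")
        case True
        have "(k - k\<^sub>0) * \<epsilon> \<le> (k - k\<^sub>0) * f x"
          using \<epsilon>[OF True] False k(2) by (intro mult_left_mono) auto
        then have "- k * f x \<le> - (k - k\<^sub>0) * \<epsilon> + - k\<^sub>0 * f x" by (simp add: algebra_simps)
        then have "exp (- k * f x) \<le> exp (- (k - k\<^sub>0) * \<epsilon>) * exp (- k\<^sub>0 * f x)"
          by (simp only: exp_add[symmetric] exp_le_cancel_iff)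
        then have "exp (- k * f x) * \<bar>g x\<bar> \<le> exp (- (k - k\<^sub>0) * \<epsilon>) * exp (- k\<^sub>0 * f x) * \<bar>g x\<bar>"
          by (rule mult_right_mono) simp
        then show ?thesis using True by (simp add: abs_mult mult.assoc)
      qed simp
      have "\<bar>laplace_main N \<nu> c T k x\<bar> \<le> C' * laplace_majorant N \<nu> c k x"
        using C'(2)[OF k(1)] False by simp
      also have "\<dots> \<le> max C C' * laplace_majorant N \<nu> c k x" using maj by (intro mult_right_mono) auto
      finally show ?thesis using 1 abs_triangle_ineq4[of "indicator R x * (exp (- k * f x) * g x)" "laplace_main N \<nu> c T k x"]
        by linarith
    qed
  qed fact
qed

lemma exp_neg_bigo_powr:
  fixes \<epsilon> k\<^sub>0 p :: real
  assumes "0 < \<epsilon>"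
  shows "(\<lambda>k. exp (- (k - k\<^sub>0) * \<epsilon>)) \<in> O[at_top](\<lambda>k. k powr p)"
proof -
  obtain n where n: "- p \<le> real n" using real_arch_simple by blast
  have lim: "((\<lambda>k. (\<epsilon> * k) ^ n / exp (\<epsilon> * k)) \<longlongrightarrow> 0) at_top"
    using assms by (intro filterlim_compose[OF tendsto_power_div_exp_0]
        filterlim_tendsto_pos_mult_at_top[OF tendsto_const _ filterlim_ident])
  have "\<forall>\<^sub>F k in at_top. (\<epsilon> * k) ^ n / exp (\<epsilon> * k) < 1"
    using order_tendstoD(2)[OF lim zero_less_one] .
  then have "\<forall>\<^sub>F k in at_top. norm (exp (- (k - k\<^sub>0) * \<epsilon>)) \<le> exp (k\<^sub>0 * \<epsilon>) / \<epsilon> ^ n * norm (k powr p)"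
    using eventually_ge_at_top[of 1]
  proof eventually_elim
    case (elim k)
    have "k powr (- p) \<le> k ^ n"
      using n elim(2) powr_mono[OF n elim(2)] by (simp add: powr_realpow)
    then have "\<epsilon> ^ n * k powr (- p) \<le> (\<epsilon> * k) ^ n"
      using assms unfolding power_mult_distrib by (intro mult_left_mono) auto
    also have "\<dots> \<le> exp (\<epsilon> * k)" using elim(1) by simp
    finally have "\<epsilon> ^ n * k powr (- p) \<le> exp (\<epsilon> * k)" .
    moreover have "exp (- (k - k\<^sub>0) * \<epsilon>) = exp (k\<^sub>0 * \<epsilon>) / exp (\<epsilon> * k)"
      by (simp add: algebra_simps exp_diff)
    ultimately have "exp (- (k - k\<^sub>0) * \<epsilon>) \<le> exp (k\<^sub>0 * \<epsilon>) / (\<epsilon> ^ n * k powr (- p))"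
      using elim(2) assms by (simp add: divide_left_mono)
    then show ?case by (simp add: powr_minus divide_inverse mult.assoc)
  qed
  then show ?thesis by (rule bigoI)
qed

theorem corollary3p3:
  fixes R :: "(real ^ 'd) set"
    and f g :: "real ^ 'd \<Rightarrow> real"
    and N \<nu> :: nat
    and f\<^sub>0 k\<^sub>0 :: real
  assumes "1 \<le> N" and "1 \<le> \<nu>"
    and "R \<in> sets lebesgue" and "0 \<in> interior R"
    and "f \<in> borel_measurable (lebesgue_on R)"
    and "g \<in> borel_measurable (lebesgue_on R)"
    and "f 0 = 0" and "\<forall>x\<in>R. x \<noteq> 0 \<longrightarrow> 0 < f x"
    and "\<forall>\<delta>>0. 0 < (INF x\<in>{x \<in> R. \<delta> \<le> norm x}. ereal (f x))"
    and "0 < k\<^sub>0"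
    and "integrable (lebesgue_on R) (\<lambda>x. exp (- k\<^sub>0 * f x) * g x)"
    and "(\<lambda>x. f x - (\<Sum>\<alpha> | \<nu> \<le> mi_size \<alpha> \<and> mi_size \<alpha> \<le> N + \<nu>.
                       1 / mi_fact \<alpha> * mixed_deriv \<alpha> f 0 * mi_power x \<alpha>))
           \<in> O[at 0](\<lambda>x. norm x ^ (N + \<nu> + 1))"
    and "(\<lambda>x. g x - (\<Sum>\<beta> | mi_size \<beta> \<le> N.
                       1 / mi_fact \<beta> * mixed_deriv \<beta> g 0 * mi_power x \<beta>))
           \<in> O[at 0](\<lambda>x. norm x ^ (N + 1))"
    and "0 < f\<^sub>0"
    and "\<forall>\<Omega>\<in>sphere 0 1.
           (\<Sum>\<alpha> | mi_size \<alpha> = \<nu>. mixed_deriv \<alpha> f 0 / mi_fact \<alpha> * mi_power \<Omega> \<alpha>) = f\<^sub>0"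
  shows "(\<forall>\<^sub>F k in at_top. integrable (lebesgue_on R) (\<lambda>x. exp (- k * f x) * g x)) \<and>
         (\<lambda>k. integral\<^sup>L (lebesgue_on R) (\<lambda>x. exp (- k * f x) * g x) -
              k powr (- real CARD('d) / real \<nu>) *
              (\<Sum>j=0..N. laplace_coeff f g f\<^sub>0 \<nu> j * k powr (- real j / real \<nu>)))
           \<in> O[at_top](\<lambda>k. k powr (- (real N + real CARD('d) + 1) / real \<nu>))"
proof -
  let ?a = "\<lambda>\<alpha>. mixed_deriv \<alpha> f 0 / mi_fact \<alpha>" and ?b = "\<lambda>\<beta>. mixed_deriv \<beta> g 0 / mi_fact \<beta>"
  let ?T = "prod_part ?a ?b \<nu>"
  let ?F = "\<lambda>k x. exp (- k * f x) * g x"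
  let ?p = "- (real N + real CARD('d) + 1) / real \<nu>"
  let ?I = "\<lambda>k. k powr (- real CARD('d) / real \<nu>) *
              (\<Sum>j=0..N. laplace_coeff f g f\<^sub>0 \<nu> j * k powr (- real j / real \<nu>))"
  have f_exp: "(\<lambda>x. f x - (\<Sum>n\<le>N. hom_part ?a (n + \<nu>) x)) \<in> O[at 0](\<lambda>x. norm x ^ (N + \<nu> + 1))"
    using assms(12) unfolding sum_mi_size_split by (simp add: hom_part_def)
  have g_exp: "(\<lambda>x. g x - (\<Sum>n\<le>N. hom_part ?b n x)) \<in> O[at 0](\<lambda>x. norm x ^ (N + 1))"
    using assms(13) by (simp add: hom_part_def sum_mi_size_split[where n = 0 and N = N, simplified])
  have lead: "hom_part ?a \<nu> x = f\<^sub>0 * norm x ^ \<nu>" for x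
    using assms(15) by (intro hom_part_eq_norm_power[OF assms(2)]) (simp add: hom_part_def)
  have nonneg: "0 \<le> f x" if "x \<in> R" for x
    using assms(7,8) that by (cases "x = 0") (auto intro: less_imp_le)
  note graded = graded_expansion_prod_part[OF f_exp g_exp, unfolded lead]
  obtain \<epsilon> C where \<epsilon>: "0 < \<epsilon>" and bound: "\<And>k x. 0 \<le> k \<Longrightarrow> k\<^sub>0 \<le> k \<Longrightarrow> x \<noteq> 0 \<Longrightarrow>
    \<bar>indicator R x * ?F k x - laplace_main N \<nu> f\<^sub>0 ?T k x\<bar> \<le>
    exp (- (k - k\<^sub>0) * \<epsilon>) * \<bar>indicator R x * ?F k\<^sub>0 x\<bar> + C * laplace_majorant N \<nu> f\<^sub>0 k x"
    by (rule laplace_pointwise_bound[OF assms(14,4) nonneg assms(9) graded(1) graded(2), where k\<^sub>0 = k\<^sub>0])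
       (assumption, (rule that; assumption))
  obtain M where "\<And>k. 0 < k \<Longrightarrow> has_bochner_integral lborel
      (laplace_majorant N \<nu> f\<^sub>0 k :: real ^ 'd \<Rightarrow> real) (M * k powr (- (real N + real DIM(real ^ 'd) + 1) / real \<nu>))"
    by (rule has_bochner_integral_laplace_majorant[OF assms(14,2), where N = N]) (rule that)
  then have M: "has_bochner_integral lborel
      (laplace_majorant N \<nu> f\<^sub>0 k :: real ^ 'd \<Rightarrow> real) (M * k powr ?p)" if "0 < k" for k
    using that by simp
  have int: "integrable (lebesgue_on R) (?F k)" if "k\<^sub>0 \<le> k" for k
  proof (rule Bochner_Integration.integrable_bound[OF assms(11)])
    show "?F k \<in> borel_measurable (lebesgue_on R)" using assms(5,6) by measurable
    show "AE x in lebesgue_on R. norm (?F k x) \<le> norm (?F k\<^sub>0 x)"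
    proof (rule AE_I2)
      fix x assume "x \<in> space (lebesgue_on R)"
      then have "k\<^sub>0 * f x \<le> k * f x" using that nonneg by (intro mult_right_mono) (auto simp: space_restrict_space)
      then show "norm (?F k x) \<le> norm (?F k\<^sub>0 x)" by (simp add: abs_mult mult_right_mono)
    qed
  qed
  have R_sets: "R \<inter> space lebesgue \<in> sets lebesgue" using assms(3) by simp
  have int_R: "integrable lebesgue (\<lambda>x. indicator R x * ?F k x)" if "k\<^sub>0 \<le> k" for k
    using int[OF that] integrable_restrict_space[OF R_sets, of "?F k"] by simp
  have restrict: "integral\<^sup>L (lebesgue_on R) (?F k) = (\<integral>x. indicator R x * ?F k x \<partial>lebesgue)" for k
    using integral_restrict_space[OF R_sets, of "?F k"] by simp
  have lebesgue: "has_bochner_integral lebesgue h z" if "has_bochner_integral lborel h z"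
    for h :: "real ^ 'd \<Rightarrow> real" and z
    using that by (auto simp: has_bochner_integral_iff integrable_completion integral_completion)
  define J where "J = (\<integral>x. \<bar>indicator R x * ?F k\<^sub>0 x\<bar> \<partial>lebesgue)"
  have est: "\<bar>integral\<^sup>L (lebesgue_on R) (?F k) - ?I k\<bar> \<le> exp (- (k - k\<^sub>0) * \<epsilon>) * J + C * (M * k powr ?p)"
    if k: "k\<^sub>0 \<le> k" for k
  proof -
    have "0 < k" using k assms(10) by simp
    note main = lebesgue[OF has_bochner_integral_laplace_main[OF \<open>0 < k\<close> assms(14,2), of N f g]]
    note maj = lebesgue[OF M[OF \<open>0 < k\<close>]]
    have diff: "integral\<^sup>L (lebesgue_on R) (?F k) - ?I k =
        (\<integral>x. indicator R x * ?F k x - laplace_main N \<nu> f\<^sub>0 ?T k x \<partial>lebesgue)"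
      unfolding restrict using int_R[OF k] main by (simp add: has_bochner_integral_iff)
    have "\<bar>integral\<^sup>L (lebesgue_on R) (?F k) - ?I k\<bar> \<le>
        (\<integral>x. \<bar>indicator R x * ?F k x - laplace_main N \<nu> f\<^sub>0 ?T k x\<bar> \<partial>lebesgue)"
      unfolding diff by (rule integral_abs_bound)
    also have "\<dots> \<le> (\<integral>x. exp (- (k - k\<^sub>0) * \<epsilon>) * \<bar>indicator R x * ?F k\<^sub>0 x\<bar> +
        C * laplace_majorant N \<nu> f\<^sub>0 k x \<partial>lebesgue)"
    proof (rule integral_mono_AE)
      show "integrable lebesgue (\<lambda>x. \<bar>indicator R x * ?F k x - laplace_main N \<nu> f\<^sub>0 ?T k x\<bar>)"
        using int_R[OF k] main by (intro integrable_abs Bochner_Integration.integrable_diff) (auto simp: has_bochner_integral_iff)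
      show "integrable lebesgue (\<lambda>x. exp (- (k - k\<^sub>0) * \<epsilon>) * \<bar>indicator R x * ?F k\<^sub>0 x\<bar> + C * laplace_majorant N \<nu> f\<^sub>0 k x)"
        using int_R[of k\<^sub>0] maj
        by (intro Bochner_Integration.integrable_add integrable_mult_right integrable_abs) (auto simp: has_bochner_integral_iff)
      have "AE x :: real ^ 'd in lebesgue. x \<noteq> 0"
        by (intro AE_completion AE_lborel_singleton)
      then show "AE x in lebesgue. \<bar>indicator R x * ?F k x - laplace_main N \<nu> f\<^sub>0 ?T k x\<bar> \<le>
         exp (- (k - k\<^sub>0) * \<epsilon>) * \<bar>indicator R x * ?F k\<^sub>0 x\<bar> + C * laplace_majorant N \<nu> f\<^sub>0 k x"
        by (rule eventually_mono) (use bound k \<open>0 < k\<close> in auto)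
    qed
    also have "\<dots> = exp (- (k - k\<^sub>0) * \<epsilon>) * J + C * (M * k powr ?p)"
      using int_R[of k\<^sub>0] maj by (simp add: J_def has_bochner_integral_iff)
    finally show ?thesis .
  qed
  have "(\<lambda>k. integral\<^sup>L (lebesgue_on R) (?F k) - ?I k) \<in> O[at_top](\<lambda>k. exp (- (k - k\<^sub>0) * \<epsilon>) * J + C * (M * k powr ?p))"
    using est by (intro bigoI[of _ 1] eventually_mono[OF eventually_ge_at_top[of k\<^sub>0]]) force
  also have "(\<lambda>k. exp (- (k - k\<^sub>0) * \<epsilon>) * J + C * (M * k powr ?p)) \<in> O[at_top](\<lambda>k. k powr ?p)"
  proof (rule sum_in_bigo)
    show "(\<lambda>k. exp (- (k - k\<^sub>0) * \<epsilon>) * J) \<in> O[at_top](\<lambda>k. k powr ?p)"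
      using landau_o.big.mult[OF exp_neg_bigo_powr[OF \<epsilon>], of "\<lambda>_. J" "\<lambda>_. 1"] by simp
    show "(\<lambda>k. C * (M * k powr ?p)) \<in> O[at_top](\<lambda>k. k powr ?p)"
      by (rule bigoI[of _ "\<bar>C * M\<bar>"]) (simp add: abs_mult mult.assoc)
  qed
  finally have remainder: "(\<lambda>k. integral\<^sup>L (lebesgue_on R) (?F k) - ?I k) \<in> O[at_top](\<lambda>k. k powr ?p)" .
  show ?thesis
    by (rule conjI[OF eventually_mono[OF eventually_ge_at_top[of k\<^sub>0] int] remainder])
qed

end
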